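(* Let $d,p\ge 1$ be integers, $\mathcal P=(\mathbf x_1,\dots,\mathbf x_p)$ points of $\mathbb R^d$, and let $(\mathbf X_i)_{i\in\mathbb N}$ be $\mathbb R^d$-valued random vectors with $\mathbf Y_i=(\mathbf 1(\mathbf X_i\le \mathbf x_1),\dots,\mathbf 1(\mathbf X_i\le \mathbf x_p))$ (inequalities componentwise). Suppose there is a probability space on which: (a) $(\mathbf Y_i)_{i\in\mathbb N}$ is a $p$-dimensional stationary time series whose long-run covariance matrix $$\Sigma=\mathrm{Cov}(\mathbf Y_1,\mathbf Y_1)+\sum_{i\ge 2}\{\mathrm{Cov}(\mathbf Y_1,\mathbf Y_i)+\mathrm{Cov}(\mathbf Y_i,\mathbf Y_1)\}$$ exists and is positive definite; (b) for each $m\in\mathbb N$, $\mathbf W_{1,m}$ and $\mathbf W_{2,m}$ are two independent $p$-dimensional standard Brownian motions; and (c) for some $0<\xi<\tfrac12$, $$\sup_{k>m}\frac{1}{(k-m)^\xi}\Big\|\sum_{i=m+1}^k\{\mathbf Y_i-\mathbb E(\mathbf Y_1)\}-\Sigma^{1/2}\mathbf W_{1,m}(k-m)\Big\|_2=O_{\mathbb P}(1),\quad \frac{1}{m^\xi}\Big\|\sum_{i=1}^m\{\mathbf Y_i-\mathbb E(\mathbf Y_1)\}-\Sigma^{1/2}\mathbf W_{2,m}(m)\Big\|_2=O_{\mathbb P}(1)$$ as $m\to\infty$. Let $\Sigma_m$ be $p\times p$ random matrices (estimators of $\Sigma$ based on $\mathbf Y_1,\dots,\mathbf Y_m$, assumed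 invertible) with $\Sigma_m\to\Sigma$ in probability, and define for $k\ge m+1$ $$D_m(k)=\max_{j\in\{m,\dots,k-1\}}\frac{j(k-j)}{m^{3/2}}\big\|\bar{\mathbf Y}_{1:j}-\bar{\mathbf Y}_{j+1:k}\big\|_{\Sigma_m^{-1}}.$$ Fix $\eta>0$. Then, as $m\to\infty$, $$\sup_{k>m}(m/k)^{\frac32+\eta}D_m(k)\ \leadsto\ \mathcal L_{p,\eta}=\sup_{1\le s\le t<\infty}t^{-\frac32-\eta}\|t\mathbf W(s)-s\mathbf W(t)\|_{I_p},$$ where $\mathbf W$ is a $p$-dimensional standard Brownian motion (the supremum on the left is over integers $k$, the one on the right over reals $s,t$). Moreover, $\mathcal L_{p,\eta}$ is almost surely finite.
   Context: For integers $1\le j\le k$, $\bar{\mathbf Y}_{j:k}=\frac{1}{k-j+1}\sum_{i=j}^k\mathbf Y_i$. For a $p\times p$ positive-definite matrix $M$ and $\mathbf y\in\mathbb R^p$, $\|\mathbf y\|_M=\sqrt{(\mathbf y^\top M\mathbf y)/p}$; $I_p$ is the $p\times p$ identity matrix; $\|\cdot\|_2$ is the Euclidean norm; $\Sigma^{1/2}$ is the symmetric positive-definite square root. $\leadsto$ denotes convergence in distribution. *)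

theory Defs
  imports "HOL-Analysis.Analysis" "HOL-Probability.Probability"
begin

definition indic_vec :: "(nat \<Rightarrow> 'a \<Rightarrow> real^'d) \<Rightarrow> ('p::finite \<Rightarrow> real^'d) \<Rightarrow> nat \<Rightarrow> 'a \<Rightarrow> real^'p" where
  "indic_vec X pts i \<omega> = (\<chi> j. if (\<forall>l. X i \<omega> $ l \<le> pts j $ l) then 1 else 0)"

text \<open>Strict stationarity of a sequence indexed by 1,2,3,...\<close>
definition stationary :: "'a measure \<Rightarrow> (nat \<Rightarrow> 'a \<Rightarrow> 'b::topological_space) \<Rightarrow> bool" where
  "stationary M Y \<longleftrightarrow> (\<forall>h n.
     distr M (PiM {..<n} (\<lambda>_. borel)) (\<lambda>\<omega>. \<lambda>i\<in>{..<n}. Y (i + 1 + h) \<omega>) =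
     distr M (PiM {..<n} (\<lambda>_. borel)) (\<lambda>\<omega>. \<lambda>i\<in>{..<n}. Y (i + 1) \<omega>))"

definition cov_mat :: "'a measure \<Rightarrow> ('a \<Rightarrow> real^'p) \<Rightarrow> ('a \<Rightarrow> real^'p) \<Rightarrow> real^'p^'p" where
  "cov_mat M U V = (\<chi> a b. integral\<^sup>L M (\<lambda>\<omega>.
      (U \<omega> $ a - integral\<^sup>L M (\<lambda>\<omega>. U \<omega> $ a)) * (V \<omega> $ b - integral\<^sup>L M (\<lambda>\<omega>. V \<omega> $ b))))"

definition pos_def :: "real^'p^'p \<Rightarrow> bool" where
  "pos_def A \<longleftrightarrow> transpose A = A \<and> (\<forall>y. y \<noteq> 0 \<longrightarrow> y \<bullet> (A *v y) > 0)"

definition mat_sqrt :: "real^'p^'p \<Rightarrow> real^'p^'p" where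
  "mat_sqrt A = (THE S. pos_def S \<and> S ** S = A)"

definition wnorm :: "real^'p^'p \<Rightarrow> real^'p \<Rightarrow> real" where
  "wnorm A y = sqrt ((y \<bullet> (A *v y)) / real CARD('p))"

definition ybar :: "(nat \<Rightarrow> 'a \<Rightarrow> real^'p) \<Rightarrow> nat \<Rightarrow> nat \<Rightarrow> 'a \<Rightarrow> real^'p" where
  "ybar Y j k \<omega> = (1 / real (k - j + 1)) *\<^sub>R (\<Sum>i\<in>{j..k}. Y i \<omega>)"

definition std_BM :: "'a measure \<Rightarrow> (real \<Rightarrow> 'a \<Rightarrow> real^'p) \<Rightarrow> bool" where
  "std_BM M W \<longleftrightarrow>
     (\<forall>t\<ge>0. W t \<in> borel_measurable M) \<and>
     (\<forall>\<omega>\<in>space M. W 0 \<omega> = 0 \<and> continuous_on {0..} (\<lambda>t. W t \<omega>)) \<and>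
     (\<forall>s t. 0 \<le> s \<and> s < t \<longrightarrow>
        distr M borel (\<lambda>\<omega>. W t \<omega> - W s \<omega>) =
        density lborel (\<lambda>x. ennreal (\<Prod>j\<in>UNIV. normal_density 0 (sqrt (t - s)) (x $ j)))) \<and>
     (\<forall>n (ts :: nat \<Rightarrow> real). 0 \<le> ts 0 \<and> (\<forall>i<n. ts i < ts (Suc i)) \<longrightarrow>
        prob_space.indep_vars M (\<lambda>_. borel) (\<lambda>i \<omega>. W (ts (Suc i)) \<omega> - W (ts i) \<omega>) {..<n})"

text \<open>Z_m = O_P(1) as m \<rightarrow> oo (extended-real valued, to allow suprema).\<close>
definition bounded_in_prob :: "'a measure \<Rightarrow> (nat \<Rightarrow> 'a \<Rightarrow> ereal) \<Rightarrow> bool" where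
  "bounded_in_prob M Z \<longleftrightarrow> (\<forall>\<epsilon>>0. \<exists>C N. \<forall>m\<ge>N.
      measure M {\<omega>\<in>space M. \<bar>Z m \<omega>\<bar> > ereal C} \<le> \<epsilon>)"

definition conv_in_prob :: "'a measure \<Rightarrow> (nat \<Rightarrow> 'a \<Rightarrow> 'b::metric_space) \<Rightarrow> 'b \<Rightarrow> bool" where
  "conv_in_prob M Z c \<longleftrightarrow> (\<forall>\<epsilon>>0. (\<lambda>m. measure M {\<omega>\<in>space M. dist (Z m \<omega>) c > \<epsilon>}) \<longlonglongrightarrow> 0)"

definition detector :: "(nat \<Rightarrow> 'a \<Rightarrow> real^'p) \<Rightarrow> (nat \<Rightarrow> 'a \<Rightarrow> real^'p^'p) \<Rightarrow> nat \<Rightarrow> nat \<Rightarrow> 'a \<Rightarrow> real" where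
  "detector Y Sm m k \<omega> = Max ((\<lambda>j. real j * real (k - j) / real m powr (3/2) *
       wnorm (matrix_inv (Sm m \<omega>)) (ybar Y 1 j \<omega> - ybar Y (j + 1) k \<omega>)) ` {m..k-1})"

definition conv_distr :: "'a measure \<Rightarrow> (nat \<Rightarrow> 'a \<Rightarrow> ereal) \<Rightarrow> 'b measure \<Rightarrow> ('b \<Rightarrow> ereal) \<Rightarrow> bool" where
  "conv_distr M T N L \<longleftrightarrow>
     weak_conv (\<lambda>m x. measure M {\<omega>\<in>space M. T m \<omega> \<le> ereal x}) (\<lambda>x. measure N {\<omega>\<in>space N. L \<omega> \<le> ereal x})"

end

theory Submission
  imports Defs
begin

text \<open>
  Since \<open>j (k - j) (mean(1..j) - mean(j+1..k)) = k S_j - j S_k\<close> for the centred partial sums \<open>S\<close>, the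
  statistic is a supremum over \<open>m \<le> j < k\<close> of weighted norms of \<open>k S_j - j S_k\<close>. The two couplings give
  \<open>S_j = \<Sigma>\<^sup>1\<^sup>/\<^sup>2 B_j + O(j\<^sup>\<xi>)\<close> for the glued path \<open>B_j = W2 m + W1 (j - m)\<close>, and \<open>\<Sigma>\<^sup>1\<^sup>/\<^sup>2\<close> cancels against the
  norm of \<open>\<Sigma>\<^sup>-\<^sup>1\<close>; the remaining error is a factor close to 1 and an additive term of order \<open>m\<close> to the power
  \<open>\<xi> - 1/2\<close>. By independence \<open>B\<close> has the law of \<open>sqrt m W (j / m)\<close>, so that the Gaussian statistic is
  distributed as the supremum defining the limit, restricted to the grid of mesh \<open>1/m\<close>. These grid
  suprema lie below the full supremum and converge to it by path continuity alone, hence so do their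
  distribution functions. The limit is finite because a Brownian path grows at most like \<open>t\<close> to the
  power \<open>1/2 + \<eta>\<close>.
\<close>

text \<open>For the convergence in distribution, no limit theorem on path space is needed. For fixed
  \<open>m\<close>, the event that a statistic stays below a level is a countable intersection of
  conditions on grid values, so that equality in law of two sequences of normal increments suffices.
  The Gaussian statistics for all \<open>m\<close> are compared with functionals of one path
  \<open>W\<close>; discretisation then becomes a pointwise statement combined with dominated
  convergence and holds at every level. Continuity of the limiting distribution function is used
  only to absorb a small shift of the level. The obstacle is the unbounded range of
  \<open>k\<close>, over which every error has to be uniform. The error of the estimator is
  therefore kept multiplicative. The coupling error enters with the power \<open>1 + \<xi>\<close>
  of \<open>k\<close>, which the weight with exponent \<open>3/2 + \<eta>\<close> dominates. Since
  \<open>j\<close> starts at \<open>m\<close>, the only value needed of the second Brownian motion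
  is the one at time \<open>m\<close>; everything later is supplied by the first.\<close>

section \<open>Square roots of positive definite matrices\<close>

text \<open>The maximiser of the Rayleigh quotient on the unit sphere of \<open>S\<close> is an eigenvector.\<close>
lemma selfadjoint_eigenvector:
  fixes f :: "'a::euclidean_space \<Rightarrow> 'a"
  assumes f: "linear f" and sa: "\<And>x y. f x \<bullet> y = x \<bullet> f y"
    and S: "subspace S" "f ` S \<subseteq> S" "S \<noteq> {0}"
  obtains v where "v \<in> S" "norm v = 1" "f v = (v \<bullet> f v) *\<^sub>R v"
proof -
  interpret linear f by (rule f)
  obtain u where u: "u \<in> S" "u \<noteq> 0"
    using S subspace_0 by blast
  have "compact (sphere 0 1 \<inter> S)"
    using S(1) by (intro compact_Int_closed closed_subspace) auto
  moreover have "u /\<^sub>R norm u \<in> sphere 0 1 \<inter> S"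
    using u S(1) by (auto simp: subspace_scale)
  then have "sphere 0 1 \<inter> S \<noteq> {}" by blast
  moreover have "continuous_on (sphere 0 1 \<inter> S) (\<lambda>x. x \<bullet> f x)"
    using f by (intro continuous_intros linear_continuous_on) (simp add: linear_conv_bounded_linear)
  ultimately obtain v where "v \<in> sphere 0 1 \<inter> S" "\<forall>x\<in>sphere 0 1 \<inter> S. x \<bullet> f x \<le> v \<bullet> f v"
    using continuous_attains_sup by blast
  then have v: "v \<in> S" "norm v = 1"
      and max: "\<And>x. x \<in> S \<Longrightarrow> norm x = 1 \<Longrightarrow> x \<bullet> f x \<le> v \<bullet> f v"
    by auto
  define l where "l = v \<bullet> f v"
  have max': "x \<bullet> f x \<le> l * (x \<bullet> x)" if "x \<in> S" for x
  proof (cases "x = 0")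
    case False
    have "(x /\<^sub>R norm x) \<bullet> f (x /\<^sub>R norm x) \<le> l"
      unfolding l_def using False that S(1) by (intro max) (auto simp: subspace_scale)
    then show ?thesis
      using False by (simp add: scale field_simps power2_norm_eq_inner flip: power2_eq_square)
  qed (simp add: zero)
  have orth: "w \<bullet> f v = 0" if w: "w \<in> S" "w \<bullet> v = 0" for w
  proof -
    define a where "a = w \<bullet> f v"
    define c where "c = l * (w \<bullet> w) - w \<bullet> f w"
    have vv: "v \<bullet> v = 1" using v by (simp add: norm_eq_1)
    \<comment> \<open>First variation: this is maximality of the Rayleigh quotient at
      \<open>v\<close>, tested along the line \<open>v + t w\<close>. A linear term cannot stay
      below a quadratic one near \<open>t = 0\<close> unless \<open>a = 0\<close>; the choice
      \<open>t = a / (\<bar>c\<bar> + 1)\<close> below makes this explicit without a sign condition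
      on \<open>c\<close>.\<close>
    have "2 * t * a \<le> t\<^sup>2 * c" for t
    proof -
      have "(v + t *\<^sub>R w) \<bullet> f (v + t *\<^sub>R w) \<le> l * ((v + t *\<^sub>R w) \<bullet> (v + t *\<^sub>R w))"
        using v w S(1) by (intro max') (auto simp: subspace_add subspace_scale)
      moreover have "v \<bullet> f w = a"
        unfolding a_def by (metis sa inner_commute)
      moreover have "v \<bullet> w = 0" using w by (simp add: inner_commute)
      ultimately show ?thesis
        using w vv by (simp add: add scale inner_add_left inner_add_right algebra_simps c_def a_def power2_eq_square flip: l_def)
    qed
    from this[of "a / (\<bar>c\<bar> + 1)"]
    have "2 * a\<^sup>2 / (\<bar>c\<bar> + 1) \<le> a\<^sup>2 * c / (\<bar>c\<bar> + 1)\<^sup>2"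
      by (simp add: power2_eq_square)
    also have "\<dots> \<le> a\<^sup>2 * (\<bar>c\<bar> + 1) / (\<bar>c\<bar> + 1)\<^sup>2"
      by (intro divide_right_mono mult_left_mono) auto
    also have "\<dots> = a\<^sup>2 / (\<bar>c\<bar> + 1)" by (simp add: power2_eq_square)
    finally have "a\<^sup>2 \<le> 0"
      by (simp add: divide_le_cancel)
    then show ?thesis by (simp add: a_def)
  qed
  define u where "u = f v - l *\<^sub>R v"
  have "u \<in> S" unfolding u_def using v S by (auto intro!: subspace_diff subspace_scale)
  moreover have uv: "u \<bullet> v = 0"
    using v sa[of v v] by (simp add: u_def l_def inner_diff_left norm_eq_1)
  ultimately have "u \<bullet> f v = 0" by (rule orth)
  then have "u \<bullet> u = 0"
    using uv by (simp add: u_def inner_diff_right)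
  then have "f v = (v \<bullet> f v) *\<^sub>R v" by (simp add: u_def l_def)
  with v show ?thesis by (rule that)
qed

text \<open>Induction on the dimension: by self-adjointness, the part of \<open>S\<close> orthogonal
  to an eigenvector is again invariant, and it is smaller. Eigenvalues are written as the Rayleigh
  quotients \<open>b \<bullet> f b\<close>, so that their positivity can be read off from positive
  definiteness.\<close>

lemma selfadjoint_eigenbasis:
  fixes f :: "'a::euclidean_space \<Rightarrow> 'a"
  assumes f: "linear f" and sa: "\<And>x y. f x \<bullet> y = x \<bullet> f y"
    and "subspace S" "f ` S \<subseteq> S"
  shows "\<exists>B. pairwise orthogonal B \<and> (\<forall>b\<in>B. norm b = 1 \<and> f b = (b \<bullet> f b) *\<^sub>R b) \<and> span B = S"
  using assms(3,4)
proof (induction "dim S" arbitrary: S rule: less_induct)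
  case less
  show ?case
  proof (cases "S = {0}")
    case True
    then show ?thesis by (intro exI[of _ "{}"]) simp
  next
    case False
    obtain v where v: "v \<in> S" "norm v = 1" "f v = (v \<bullet> f v) *\<^sub>R v"
      using selfadjoint_eigenvector[OF f sa less.prems False] .
    have vv: "v \<bullet> v = 1" using v by (simp add: norm_eq_1)
    define T where "T = {x \<in> S. v \<bullet> x = 0}"
    have T: "subspace T"
      using less.prems(1) unfolding T_def by (auto simp: subspace_def inner_add_right)
    have "v \<bullet> f x = 0" if "v \<bullet> x = 0" for x
      by (metis sa v(3) that inner_scaleR_left mult_zero_right)
    then have fT: "f ` T \<subseteq> T" using less.prems(2) by (auto simp: T_def)
    have "v \<notin> T" using vv by (simp add: T_def)
    then have "T \<subset> S" using v(1) unfolding T_def by blast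
    then have "dim T < dim S"
      using T less.prems(1) by (intro dim_psubset) (simp add: span_eq_iff[THEN iffD2])
    from less.hyps[OF this T fT] obtain B where B: "pairwise orthogonal B"
      "\<forall>b\<in>B. norm b = 1 \<and> f b = (b \<bullet> f b) *\<^sub>R b" "span B = T" by blast
    have BT: "B \<subseteq> T" using B(3) span_superset by blast
    have "span (insert v B) = S"
    proof
      show "span (insert v B) \<subseteq> S"
        using BT v less.prems(1) by (intro span_minimal) (auto simp: T_def)
      show "S \<subseteq> span (insert v B)"
      proof
        fix x assume x: "x \<in> S"
        have "x - (v \<bullet> x) *\<^sub>R v \<in> T"
          using x v vv less.prems(1) by (auto simp: T_def inner_diff_right intro!: subspace_diff subspace_scale)
        then show "x \<in> span (insert v B)"
          using B(3) by (auto simp: span_breakdown_eq)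
      qed
    qed
    moreover have "pairwise orthogonal (insert v B)"
      using B(1) BT by (auto simp: pairwise_insert orthogonal_def T_def inner_commute)
    ultimately show ?thesis using B(2) v by (intro exI[of _ "insert v B"]) auto
  qed
qed

lemma pos_def_selfadjoint:
  assumes "pos_def A"
  shows "(A *v x) \<bullet> y = x \<bullet> (A *v y)"
  using assms by (metis pos_def_def dot_lmul_matrix vector_transpose_matrix)

lemma pos_def_kernel:
  assumes "pos_def A" "A *v x = 0"
  shows "x = 0"
  using assms unfolding pos_def_def by fastforce

lemma pos_def_invertible: "pos_def A \<Longrightarrow> invertible A"
  by (metis invertible_left_inverse matrix_left_invertible_ker pos_def_kernel)

lemma pos_def_eigenbasis:
  fixes A :: "real^'p^'p"
  assumes "pos_def A"
  obtains B where "finite B" "pairwise orthogonal B" "\<And>b. b \<in> B \<Longrightarrow> norm b = 1"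
    "\<And>b. b \<in> B \<Longrightarrow> A *v b = (b \<bullet> (A *v b)) *\<^sub>R b" "\<And>b. b \<in> B \<Longrightarrow> 0 < b \<bullet> (A *v b)" "span B = UNIV"
proof -
  obtain B where B: "pairwise orthogonal B" "\<forall>b\<in>B. norm b = 1 \<and> A *v b = (b \<bullet> (A *v b)) *\<^sub>R b" "span B = UNIV"
    using selfadjoint_eigenbasis[of "(*v) A" UNIV] pos_def_selfadjoint[OF assms] by auto
  moreover have "finite B"
    using B(1,2) by (intro independent_imp_finite pairwise_orthogonal_independent) auto
  moreover have "0 < b \<bullet> (A *v b)" if "b \<in> B" for b
    using assms B(2) that unfolding pos_def_def by (metis norm_zero zero_neq_one)
  ultimately show ?thesis using that by blast
qed

text \<open>This is the uniqueness half of the square root: on an eigenbasis of \<open>A\<close>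
  every positive definite root is forced to act by the same scalars.\<close>

lemma pos_def_sqrt_eigenvector:
  assumes S: "pos_def S" "S ** S = A" and b: "A *v b = l *\<^sub>R b" "0 < l"
  shows "S *v b = sqrt l *\<^sub>R b"
proof -
  \<comment> \<open>\<open>(S + sqrt l) w = (A - l) b = 0\<close>, and \<open>S + sqrt l\<close> is injective.\<close>
  define w where "w = S *v b - sqrt l *\<^sub>R b"
  have "S *v w + sqrt l *\<^sub>R w = A *v b - l *\<^sub>R b"
    using b by (simp add: w_def matrix_vector_mult_diff_distrib matrix_vector_mul_assoc S(2) scaleR_diff_right
        matrix_vector_mult_scaleR)
  then have eq: "S *v w = - (sqrt l *\<^sub>R w)" using b by (simp add: eq_neg_iff_add_eq_0)
  have "w = 0"
  proof (rule ccontr)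
    assume "w \<noteq> 0"
    then have "0 < w \<bullet> (S *v w)" using S by (simp add: pos_def_def)
    also have "\<dots> \<le> 0" using b by (simp add: eq)
    finally show False by simp
  qed
  then show ?thesis by (simp add: w_def)
qed

text \<open>\<open>mat_sqrt\<close> is a definite description, so nothing can be said about it
  before both existence and uniqueness are known. The root is built spectrally: \<open>g\<close>
  rescales each eigenvector by the root of its eigenvalue, and matrices that agree on the spanning
  set \<open>B\<close> coincide.\<close>

lemma ex1_pos_def_sqrt:
  fixes A :: "real^'p^'p"
  assumes A: "pos_def A"
  shows "\<exists>!S. pos_def S \<and> S ** S = A"
proof -
  from A obtain B where B: "finite B" "pairwise orthogonal B" "\<And>b. b \<in> B \<Longrightarrow> norm b = 1"
    "\<And>b. b \<in> B \<Longrightarrow> A *v b = (b \<bullet> (A *v b)) *\<^sub>R b" "\<And>b. b \<in> B \<Longrightarrow> 0 < b \<bullet> (A *v b)" "span B = UNIV"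
    by (rule pos_def_eigenbasis) blast
  define r where "r b = sqrt (b \<bullet> (A *v b))" for b
  define g where "g x = (\<Sum>b\<in>B. (r b * (b \<bullet> x)) *\<^sub>R b)" for x
  have g: "linear g"
    unfolding g_def by (intro linearI) (auto simp: inner_add_right algebra_simps sum.distrib scaleR_sum_right)
  have gb: "g b = r b *\<^sub>R b" if b: "b \<in> B" for b
  proof -
    have "g b = (\<Sum>c\<in>{b}. (r c * (c \<bullet> b)) *\<^sub>R c)"
      unfolding g_def using B(1,2) b
      by (intro sum.mono_neutral_right) (auto simp: pairwise_def orthogonal_def)
    also have "\<dots> = r b *\<^sub>R b" using B(3)[OF b] by (simp add: norm_eq_1)
    finally show ?thesis .
  qed
  define S where "S = matrix g"
  have S: "S *v x = g x" for x using g by (simp add: S_def matrix_works)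
  have eqI: "P = Q" if "\<And>b. b \<in> B \<Longrightarrow> P *v b = Q *v b" for P Q :: "real^'p^'p"
  proof -
    have "P *v x = Q *v x" for x
      using linear_eq_on_span[of "(*v) P" "(*v) Q" B x] that B(6) by auto
    then show ?thesis by (simp add: matrix_eq)
  qed
  have sym: "(S *v x) \<bullet> y = x \<bullet> (S *v y)" for x y
    by (simp add: S g_def inner_sum_left inner_sum_right mult_ac inner_commute)
  have "transpose S = S"
  proof -
    have "transpose S *v x = S *v x" for x
    proof (rule vector_eq_ldot[THEN iffD1], rule allI)
      fix y show "y \<bullet> (transpose S *v x) = y \<bullet> (S *v x)"
        by (metis sym dot_lmul_matrix vector_transpose_matrix)
    qed
    then show ?thesis by (simp add: matrix_eq)
  qed
  moreover have "0 < y \<bullet> (S *v y)" if "y \<noteq> 0" for y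
  proof -
    \<comment> \<open>In orthonormal coordinates the quadratic form is a sum of squares with
      positive weights \<open>r b\<close>, and a nonzero vector has some nonzero coordinate.\<close>
    have "y \<in> span B" using B by simp
    then have y: "(\<Sum>b\<in>B. (b \<bullet> y) *\<^sub>R b) = y"
      using orthonormal_basis_expand[of B y] B by (simp add: inner_commute)
    have "\<exists>b\<in>B. b \<bullet> y \<noteq> 0"
      using that y by (metis (no_types, lifting) scale_eq_0_iff sum.neutral)
    moreover have "y \<bullet> (S *v y) = (\<Sum>b\<in>B. r b * (b \<bullet> y)\<^sup>2)"
      by (simp add: S g_def inner_sum_right power2_eq_square inner_commute mult_ac)
    moreover have "r b > 0" if "b \<in> B" for b using B(5)[OF that] by (simp add: r_def)
    ultimately show ?thesis
      using B(1) by (auto intro!: sum_pos2 simp: less_imp_le)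
  qed
  ultimately have "pos_def S" by (simp add: pos_def_def)
  moreover have "S ** S = A"
  proof (rule eqI)
    fix b assume b: "b \<in> B"
    have "(S ** S) *v b = S *v (S *v b)" by (simp add: matrix_vector_mul_assoc)
    also have "\<dots> = r b *\<^sub>R g b" using g b by (simp add: S gb linear_cmul)
    also have "\<dots> = (r b * r b) *\<^sub>R b" using b by (simp add: gb)
    also have "\<dots> = A *v b" using B(4,5)[OF b] by (simp add: r_def)
    finally show "(S ** S) *v b = A *v b" .
  qed
  moreover have "P = Q" if "pos_def P \<and> P ** P = A" "pos_def Q \<and> Q ** Q = A" for P Q
    using that pos_def_sqrt_eigenvector[OF _ _ B(4,5)] by (intro eqI) simp
  ultimately show ?thesis by blast
qed

lemma mat_sqrt:
  assumes "pos_def A"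
  shows "pos_def (mat_sqrt A)" "mat_sqrt A ** mat_sqrt A = A"
  using theI'[OF ex1_pos_def_sqrt[OF assms]] by (auto simp: mat_sqrt_def)

section \<open>Inverses of matrices and weighted norms\<close>

lemma continuous_on_det: "continuous_on S (det :: real^'n^'n \<Rightarrow> real)"
  unfolding det_def by (intro continuous_intros)

lemma matrix_inv_mult:
  fixes A :: "real^'n^'n"
  assumes "invertible A"
  shows "A ** matrix_inv A = mat 1" "matrix_inv A ** A = mat 1"
  using someI_ex[of "\<lambda>B. A ** B = mat 1 \<and> B ** A = mat 1"] assms
  by (auto simp: invertible_def matrix_inv_def)

text \<open>Cramer's rule for the columns of the inverse. It exhibits each entry as a quotient of
  polynomials in the entries of \<open>A\<close>, which gives continuity at once.\<close>

lemma matrix_inv_cramer: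
  fixes A :: "real^'n^'n"
  assumes "invertible A"
  shows "matrix_inv A $ k $ l = det (\<chi> i j. if j = k then axis l 1 $ i else A $ i $ j) / det A"
proof -
  have "A *v (matrix_inv A *v axis l 1) = axis l 1"
    by (simp add: matrix_vector_mul_assoc matrix_inv_mult[OF assms])
  then have "matrix_inv A *v axis l 1 = (\<chi> k. det (\<chi> i j. if j = k then axis l 1 $ i else A $ i $ j) / det A)"
    using assms by (subst (asm) cramer) (simp_all add: invertible_det_nz)
  then show ?thesis
    by (simp add: matrix_vector_mult_basis column_def vec_eq_iff)
qed

lemma continuous_on_matrix_inv: "continuous_on {A :: real^'n^'n. invertible A} matrix_inv"
proof -
  have entry: "continuous_on T (\<lambda>A. if j = k then c else A $ i $ j)" for T :: "(real^'n^'n) set" and i j k c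
    by (cases "j = k") (auto intro!: continuous_intros)
  have "continuous_on {A :: real^'n^'n. invertible A} (\<lambda>A. \<chi> k l.
    det (\<chi> i j. if j = k then axis l 1 $ i else A $ i $ j) / det A)"
    by (intro continuous_on_vec_lambda continuous_on_divide continuous_on_compose2[OF continuous_on_det])
       (auto simp: invertible_det_nz intro!: continuous_on_det continuous_on_vec_lambda entry)
  then show ?thesis
    by (rule continuous_on_eq) (simp add: vec_eq_iff matrix_inv_cramer)
qed

lemma open_invertible: "open {A :: real^'n^'n. invertible A}"
  unfolding invertible_det_nz by (intro open_Collect_neq continuous_on_det continuous_on_const)

lemma norm_matrix_vector_le:
  fixes A :: "real^'n^'m"
  shows "norm (A *v x) \<le> (\<Sum>i\<in>UNIV. \<Sum>j\<in>UNIV. \<bar>A $ i $ j\<bar>) * norm x"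
  using onorm[OF matrix_vector_mul_bounded_linear, of A x] onorm_le_matrix_component_sum[of A]
  by (meson mult_right_mono norm_ge_zero order_trans)

lemma wnorm_scaleR: "0 \<le> c \<Longrightarrow> wnorm A (c *\<^sub>R y) = c * wnorm A y"
  by (simp add: wnorm_def matrix_vector_mult_scaleR real_sqrt_mult real_sqrt_divide flip: power2_eq_square mult.assoc)

lemma wnorm_mat_1: "wnorm (mat 1) (y :: real^'p) = norm y / sqrt CARD('p)"
  by (simp add: wnorm_def real_sqrt_divide norm_eq_sqrt_inner)

text \<open>Here the square root cancels: the form of the inverse of \<open>A\<close> at
  \<open>S *v z\<close> is the form of \<open>Q A\<close> at \<open>z\<close>, and
  \<open>Q \<Sigma>\<close> is the identity. The error is relative and \<open>d\<close> does not
  depend on \<open>z\<close>, so one neighbourhood serves all indices \<open>j\<close> and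
  \<open>k\<close>.\<close>

lemma wnorm_matrix_inv_near:
  fixes \<Sigma> S :: "real^'p^'p"
  assumes S: "pos_def S" "S ** S = \<Sigma>" and e: "0 < e" "e < 1"
  obtains d where "0 < d" "\<And>A z. dist A \<Sigma> < d \<Longrightarrow> invertible A \<Longrightarrow>
    wnorm (matrix_inv A) (S *v z) \<in> {(1 - e) * wnorm (mat 1) z..(1 + e) * wnorm (mat 1) z}"
proof -
  have invS: "invertible S" using S(1) by (rule pos_def_invertible)
  have inv: "invertible \<Sigma>" using invertible_mult[OF invS invS] S by simp
  define Q where "Q A = S ** matrix_inv A ** S" for A
  have Q1: "Q \<Sigma> = mat 1"
  proof -
    \<comment> \<open>Multiplied by \<open>S\<close> on both sides, \<open>Q \<Sigma>\<close>
      becomes \<open>\<Sigma>\<close> times its inverse times \<open>\<Sigma>\<close>, that is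
      \<open>S ** S\<close>; the outer factors then cancel by invertibility.\<close>
    have "S ** (Q \<Sigma> ** S) = S ** S"
      by (metis Q_def S(2) inv matrix_inv_mult(1) matrix_mul_assoc matrix_mul_lid)
    then show ?thesis
      by (metis invS matrix_inv_mult matrix_mul_assoc matrix_mul_lid matrix_mul_rid)
  qed
  \<comment> \<open>The entry sum dominates the operator norm of \<open>Q A - mat 1\<close>, is
    continuous on invertible matrices and vanishes at \<open>\<Sigma>\<close>.\<close>
  define f where "f A = (\<Sum>i\<in>UNIV. \<Sum>j\<in>UNIV. \<bar>(Q A - mat 1) $ i $ j\<bar>)" for A
  have "continuous_on {A. invertible A} f"
    unfolding f_def Q_def matrix_matrix_mult_def
    by (auto intro!: continuous_intros continuous_on_matrix_inv)
  then have "isCont f \<Sigma>"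
    using inv open_invertible continuous_on_eq_continuous_at by blast
  moreover have "f \<Sigma> = 0" by (simp add: f_def Q1)
  ultimately obtain d where d: "0 < d" "\<And>A. dist A \<Sigma> < d \<Longrightarrow> \<bar>f A\<bar> < e"
    using e by (auto simp: continuous_at_eps_delta dist_real_def)
  show ?thesis
  proof (rule that[OF d(1)])
    fix A :: "real^'p^'p" and z :: "real^'p"
    assume A: "dist A \<Sigma> < d"
    define q where "q = (S *v z) \<bullet> (matrix_inv A *v (S *v z))"
    have q: "q = z \<bullet> (Q A *v z)"
      unfolding q_def Q_def using pos_def_selfadjoint[OF S(1)] by (simp add: matrix_vector_mul_assoc matrix_mul_assoc)
    have "\<bar>q - z \<bullet> z\<bar> = \<bar>z \<bullet> ((Q A - mat 1) *v z)\<bar>"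
      by (simp add: q matrix_vector_mult_diff_rdistrib inner_diff_right)
    also have "\<dots> \<le> norm z * norm ((Q A - mat 1) *v z)" by (rule Cauchy_Schwarz_ineq2)
    also have "\<dots> \<le> norm z * (e * norm z)"
    proof (rule mult_left_mono)
      have "norm ((Q A - mat 1) *v z) \<le> f A * norm z"
        unfolding f_def by (rule norm_matrix_vector_le)
      also have "\<dots> \<le> e * norm z" using d(2)[OF A] by (intro mult_right_mono) auto
      finally show "norm ((Q A - mat 1) *v z) \<le> e * norm z" .
    qed simp
    also have "\<dots> = e * (norm z)\<^sup>2" by (simp add: power2_eq_square)
    finally have qb: "\<bar>q - (norm z)\<^sup>2\<bar> \<le> e * (norm z)\<^sup>2" by (simp add: power2_norm_eq_inner)
    \<comment> \<open>The bounds on \<open>q\<close> have factors \<open>1 - e\<close> and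
      \<open>1 + e\<close>. Since \<open>(1 - e)\<^sup>2 \<le> 1 - e\<close> and
      \<open>1 + e \<le> (1 + e)\<^sup>2\<close>, the same factors survive after taking
      roots.\<close>
    have "((1 - e) * norm z)\<^sup>2 \<le> (1 - e) * (norm z)\<^sup>2"
      unfolding power_mult_distrib using e by (intro mult_right_mono) (auto simp: power2_eq_square mult_left_le)
    also have "\<dots> \<le> q" using qb by (simp add: algebra_simps abs_le_iff)
    finally have lo: "(1 - e) * norm z \<le> sqrt q" by (rule real_le_rsqrt)
    have "q \<le> (1 + e) * (norm z)\<^sup>2" using qb by (simp add: algebra_simps abs_le_iff)
    also have "\<dots> \<le> ((1 + e) * norm z)\<^sup>2"
      unfolding power_mult_distrib using e by (intro mult_right_mono) (auto simp: power2_eq_square algebra_simps)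
    finally have hi: "sqrt q \<le> (1 + e) * norm z" using e by (intro real_le_lsqrt) auto
    have "wnorm (matrix_inv A) (S *v z) = sqrt q / sqrt CARD('p)"
      by (simp add: wnorm_def q_def real_sqrt_divide)
    with lo hi show "wnorm (matrix_inv A) (S *v z) \<in> {(1 - e) * wnorm (mat 1) z..(1 + e) * wnorm (mat 1) z}"
      by (simp add: wnorm_mat_1 divide_right_mono)
  qed
qed

section \<open>Increments of Brownian motion\<close>

lemma prod_normal_density:
  fixes x :: "real^'p"
  assumes "0 < h"
  shows "(\<Prod>j\<in>UNIV. normal_density 0 (sqrt h) (x $ j)) =
    (1 / sqrt (2 * pi * h)) ^ CARD('p) * exp (- (norm x)\<^sup>2 / (2 * h))"
proof -
  have "(norm x)\<^sup>2 = (\<Sum>j\<in>UNIV. (x $ j)\<^sup>2)"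
    by (simp add: power2_norm_eq_inner inner_vec_def flip: power2_eq_square)
  then show ?thesis
    using assms by (simp add: normal_density_def prod.distrib prod_dividef power_divide exp_sum[symmetric] sum_negf sum_divide_distrib)
qed

text \<open>The centred normal law with variance \<open>h\<close> in each independent coordinate,
  with the density spelled exactly as in \<open>std_BM\<close>, so that the law of an increment is
  obtained by unfolding.\<close>

definition gaussian :: "real \<Rightarrow> (real^'p) measure" where
  "gaussian h = density lborel (\<lambda>x. ennreal (\<Prod>j\<in>UNIV. normal_density 0 (sqrt h) (x $ j)))"

lemma sets_gaussian[measurable_cong, simp]: "sets (gaussian h) = sets borel"
  and space_gaussian[simp]: "space (gaussian h) = UNIV"
  by (simp_all add: gaussian_def)

text \<open>Change of variables: the Jacobian \<open>c ^ CARD('p)\<close> is absorbed by the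
  normalising constants, one factor \<open>c\<close> per coordinate, while the exponent is
  invariant.\<close>

lemma gaussian_scale:
  assumes h: "0 < h" and c: "0 < c"
  shows "distr (gaussian h) borel ((*\<^sub>R) c) = (gaussian (c\<^sup>2 * h) :: (real^'p) measure)"
proof (rule measure_eqI)
  show "sets (distr (gaussian h) borel ((*\<^sub>R) c)) = sets (gaussian (c\<^sup>2 * h))" by simp
  fix A :: "(real^'p) set"
  assume "A \<in> sets (distr (gaussian h) borel ((*\<^sub>R) c))"
  then have A[measurable]: "A \<in> sets borel" by simp
  have [measurable]: "(*\<^sub>R) c -` A \<in> sets borel"
    by (rule measurable_sets_borel[OF _ A]) measurable
  let ?g = "\<lambda>h (x::real^'p). \<Prod>j\<in>UNIV. normal_density 0 (sqrt h) (x $ j)"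
  have scale: "c ^ CARD('p) * ?g (c\<^sup>2 * h) (c *\<^sub>R x) = ?g h x" for x
  proof -
    have "c * (1 / sqrt (2 * pi * (c\<^sup>2 * h))) = 1 / sqrt (2 * pi * h)"
      using c h by (simp add: real_sqrt_mult)
    moreover have "(norm (c *\<^sub>R x))\<^sup>2 / (2 * (c\<^sup>2 * h)) = (norm x)\<^sup>2 / (2 * h)"
      using c h by (simp add: power_mult_distrib)
    moreover have "c ^ CARD('p) * ?g (c\<^sup>2 * h) (c *\<^sub>R x)
      = (c * (1 / sqrt (2 * pi * (c\<^sup>2 * h)))) ^ CARD('p) * exp (- ((norm (c *\<^sub>R x))\<^sup>2 / (2 * (c\<^sup>2 * h))))"
      using c h by (subst prod_normal_density) (simp_all add: power_mult_distrib power_divide)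
    ultimately show ?thesis
      using h by (simp add: prod_normal_density)
  qed
  have "emeasure (gaussian (c\<^sup>2 * h)) A = (\<integral>\<^sup>+x. ennreal (?g (c\<^sup>2 * h) x) * indicator A x \<partial>lborel)"
    by (simp add: gaussian_def emeasure_density)
  also have "\<dots> = (\<integral>\<^sup>+x. ennreal (?g (c\<^sup>2 * h) x) * indicator A x \<partial>density (distr lborel borel (\<lambda>x. 0 + c *\<^sub>R x)) (\<lambda>_. ennreal (\<bar>c\<bar> ^ DIM(real^'p))))"
    using c by (subst lborel_affine[of c 0]) auto
  also have "\<dots> = (\<integral>\<^sup>+x. ennreal (c ^ CARD('p)) * (ennreal (?g (c\<^sup>2 * h) (c *\<^sub>R x)) * indicator A (c *\<^sub>R x)) \<partial>lborel)"
    using c by (simp add: nn_integral_density nn_integral_distr)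
  also have "\<dots> = (\<integral>\<^sup>+x. ennreal (?g h x) * indicator ((*\<^sub>R) c -` A) x \<partial>lborel)"
    using c by (intro nn_integral_cong)
      (auto simp: indicator_def scale[symmetric] ennreal_mult[symmetric] prod_nonneg)
  also have "\<dots> = emeasure (gaussian h) ((*\<^sub>R) c -` A)"
    by (simp add: gaussian_def emeasure_density)
  also have "\<dots> = emeasure (distr (gaussian h) borel ((*\<^sub>R) c)) A"
    by (simp add: emeasure_distr)
  finally show "emeasure (distr (gaussian h) borel ((*\<^sub>R) c)) A = emeasure (gaussian (c\<^sup>2 * h)) A" ..
qed

text \<open>The density of variance \<open>h\<close> is \<open>sqrt 2 ^ p * exp (- |x|\<^sup>2 / (4 h))\<close> times the density of variance \<open>2 h\<close>,
  so no moment has to be integrated.\<close>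
lemma gaussian_tail:
  assumes h: "0 < h" and prob: "prob_space (gaussian (2 * h) :: (real^'p) measure)" and r: "0 \<le> r"
  shows "emeasure (gaussian h) {x :: real^'p. r < norm x} \<le> ennreal (sqrt 2 ^ CARD('p) * exp (- r\<^sup>2 / (4 * h)))"
proof -
  let ?g = "\<lambda>h (x::real^'p). \<Prod>j\<in>UNIV. normal_density 0 (sqrt h) (x $ j)"
  let ?C = "sqrt 2 ^ CARD('p) * exp (- r\<^sup>2 / (4 * h))"
  have le: "?g h x \<le> ?C * ?g (2 * h) x" if "r < norm x" for x
  proof -
    have "r\<^sup>2 \<le> (norm x)\<^sup>2" using that r by (intro power_mono) auto
    then have e: "exp (- (norm x)\<^sup>2 / (2 * h)) \<le> exp (- r\<^sup>2 / (4 * h)) * exp (- (norm x)\<^sup>2 / (2 * (2 * h)))"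
      using h by (simp add: exp_add[symmetric] field_simps)
    define k where "k = 1 / sqrt (2 * pi * (2 * h))"
    have "1 / sqrt (2 * pi * h) = sqrt 2 * k"
      using h by (simp add: k_def real_sqrt_mult field_simps)
    then have g1: "?g h x = sqrt 2 ^ CARD('p) * k ^ CARD('p) * exp (- (norm x)\<^sup>2 / (2 * h))"
      by (simp only: prod_normal_density[OF h] power_mult_distrib)
    have g2: "?g (2 * h) x = k ^ CARD('p) * exp (- (norm x)\<^sup>2 / (2 * (2 * h)))"
      unfolding k_def using h by (intro prod_normal_density) simp
    have "0 \<le> sqrt 2 ^ CARD('p) * k ^ CARD('p)"
      using h by (simp add: k_def)
    from mult_left_mono[OF e this] show ?thesis
      unfolding g1 g2 by (simp only: mult_ac)
  qed
  have "emeasure (gaussian h) {x :: real^'p. r < norm x} = (\<integral>\<^sup>+x. ennreal (?g h x) * indicator {x. r < norm x} x \<partial>lborel)"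
    by (simp add: gaussian_def emeasure_density)
  also have "\<dots> \<le> (\<integral>\<^sup>+x. ennreal ?C * ennreal (?g (2 * h) x) \<partial>lborel)"
    using le by (intro nn_integral_mono) (auto simp: indicator_def ennreal_mult'[symmetric] intro!: ennreal_leI)
  also have "\<dots> = ennreal ?C * emeasure (gaussian (2 * h)) (UNIV :: (real^'p) set)"
    by (simp add: nn_integral_cmult gaussian_def emeasure_density)
  also have "emeasure (gaussian (2 * h)) (UNIV :: (real^'p) set) = 1"
    using prob_space.emeasure_space_1[OF prob] by simp
  finally show ?thesis by simp
qed

lemma std_BM_measurable: "std_BM N W \<Longrightarrow> 0 \<le> t \<Longrightarrow> W t \<in> borel_measurable N"
  by (simp add: std_BM_def)

lemma std_BM_zero: "std_BM N W \<Longrightarrow> \<omega> \<in> space N \<Longrightarrow> W 0 \<omega> = 0"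
  by (simp add: std_BM_def)

lemma std_BM_continuous: "std_BM N W \<Longrightarrow> \<omega> \<in> space N \<Longrightarrow> continuous_on {0..} (\<lambda>t. W t \<omega>)"
  by (simp add: std_BM_def)

lemma std_BM_increment:
  "std_BM N W \<Longrightarrow> 0 \<le> s \<Longrightarrow> s < t \<Longrightarrow> distr N borel (\<lambda>\<omega>. W t \<omega> - W s \<omega>) = gaussian (t - s)"
  by (simp add: std_BM_def gaussian_def)

lemma std_BM_tail:
  fixes W :: "real \<Rightarrow> 'b \<Rightarrow> real^'p"
  assumes "prob_space N" and W: "std_BM N W" and "0 \<le> s" "s < t" "0 \<le> r"
  shows "measure N {\<omega>\<in>space N. r < norm (W t \<omega> - W s \<omega>)} \<le> sqrt 2 ^ CARD('p) * exp (- r\<^sup>2 / (4 * (t - s)))"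
proof -
  interpret prob_space N by fact
  have [measurable]: "W u \<in> borel_measurable N" if "0 \<le> u" for u using W that by (rule std_BM_measurable)
  \<comment> \<open>\<open>gaussian_tail\<close> requires total mass one at the doubled variance. An
    increment over twice the time span has exactly this law, so the normalisation comes from the
    Brownian motion itself.\<close>
  have "prob_space (distr N borel (\<lambda>\<omega>. W (s + 2 * (t - s)) \<omega> - W s \<omega>))"
    using assms by (intro prob_space_distr) measurable
  also have "distr N borel (\<lambda>\<omega>. W (s + 2 * (t - s)) \<omega> - W s \<omega>) = gaussian (2 * (t - s))"
    using std_BM_increment[OF W, of s "s + 2 * (t - s)"] assms by simp
  finally have prob: "prob_space (gaussian (2 * (t - s)) :: (real^'p) measure)" .
  have "emeasure N {\<omega>\<in>space N. r < norm (W t \<omega> - W s \<omega>)}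
      = emeasure (distr N borel (\<lambda>\<omega>. W t \<omega> - W s \<omega>)) {x. r < norm x}"
    using assms by (subst emeasure_distr) (auto intro!: arg_cong[where f = "emeasure N"])
  also have "\<dots> = emeasure (gaussian (t - s)) {x :: real^'p. r < norm x}"
    using std_BM_increment[OF W] assms by simp
  also have "\<dots> \<le> ennreal (sqrt 2 ^ CARD('p) * exp (- r\<^sup>2 / (4 * (t - s))))"
    using assms prob by (intro gaussian_tail) auto
  finally show ?thesis
    by (simp add: emeasure_eq_measure)
qed

section \<open>Growth of Brownian paths\<close>

text \<open>A dyadic point that is new at level \<open>l + 1\<close> has its left neighbour at level
  \<open>l\<close>, so each level costs at most one increment and the total is a geometric sum.
  Continuity carries the bound from dyadic points to all of \<open>[0, 1]\<close>.\<close>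

lemma dyadic_chaining:
  fixes f :: "real \<Rightarrow> 'a::real_normed_vector"
  assumes f: "continuous_on {0..1} f" and q: "0 \<le> q" "q < 1" and a: "0 \<le> a"
    and inc: "\<And>l i. i < 2 ^ l \<Longrightarrow> norm (f (real (Suc i) / 2 ^ l) - f (real i / 2 ^ l)) \<le> a * q ^ l"
    and t: "t \<in> {0..1}"
  shows "norm (f t - f 0) \<le> a / (1 - q)"
proof -
  have partial: "norm (f (real i / 2 ^ l) - f 0) \<le> a * (\<Sum>r\<le>l. q ^ r)" if "i \<le> 2 ^ l" for i l
    using that
  proof (induction l arbitrary: i)
    case 0
    then consider "i = 0" | "i = 1" by force
    then show ?case using inc[of 0 0] a by cases auto
  next
    case (Suc l)
    have even: "norm (f (real (2 * k) / 2 ^ Suc l) - f 0) \<le> a * (\<Sum>r\<le>l. q ^ r)" if "k \<le> 2 ^ l" for k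
      using Suc.IH[OF that] by simp
    have mono: "a * (\<Sum>r\<le>l. q ^ r) + a * q ^ Suc l = a * (\<Sum>r\<le>Suc l. q ^ r)"
      by (simp add: algebra_simps)
    show ?case
    proof (cases "even i")
      case True
      then obtain k where "i = 2 * k" by blast
      then have "norm (f (real i / 2 ^ Suc l) - f 0) \<le> a * (\<Sum>r\<le>l. q ^ r)"
        using even[of k] Suc.prems by simp
      moreover have "0 \<le> a * q ^ Suc l" using a q by simp
      ultimately show ?thesis using mono by linarith
    next
      case False
      then obtain k where k: "i = Suc (2 * k)" by (metis oddE Suc_eq_plus1)
      have lt: "2 * k < 2 ^ Suc l" using k Suc.prems by simp
      have "norm (f (real i / 2 ^ Suc l) - f 0)
        \<le> norm (f (real (Suc (2 * k)) / 2 ^ Suc l) - f (real (2 * k) / 2 ^ Suc l)) + norm (f (real (2 * k) / 2 ^ Suc l) - f 0)"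
        unfolding k by (rule norm_diff_triangle_ineq[THEN order_trans[rotated]]) simp
      also have "\<dots> \<le> a * q ^ Suc l + a * (\<Sum>r\<le>l. q ^ r)"
        using lt by (intro add_mono inc even) auto
      finally show ?thesis using mono by simp
    qed
  qed
  \<comment> \<open>Dyadic approximation from below: rounding down keeps the points inside
    \<open>[0, 1]\<close>.\<close>
  define u where "u l = real (nat \<lfloor>t * 2 ^ l\<rfloor>) / 2 ^ l" for l
  have u: "u l \<in> {0..1}" "norm (f (u l) - f 0) \<le> a / (1 - q)" "t - (1/2) ^ l \<le> u l" "u l \<le> t" for l
  proof -
    have le: "nat \<lfloor>t * 2 ^ l\<rfloor> \<le> 2 ^ l"
    proof -
      have "t * 2 ^ l \<le> 2 ^ l" using t by simp
      then have "\<lfloor>t * 2 ^ l\<rfloor> \<le> \<lfloor>2 ^ l :: real\<rfloor>" by (rule floor_mono)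
      also have "\<lfloor>2 ^ l :: real\<rfloor> = 2 ^ l" by (metis floor_of_int of_int_numeral of_int_power)
      finally show ?thesis by (simp add: nat_le_iff)
    qed
    have real: "real (nat \<lfloor>t * 2 ^ l\<rfloor>) = of_int \<lfloor>t * 2 ^ l\<rfloor>" using t by simp
    have "real (nat \<lfloor>t * 2 ^ l\<rfloor>) \<le> 2 ^ l"
      using le by (metis of_nat_le_iff of_nat_numeral of_nat_power)
    then show "u l \<in> {0..1}" by (simp add: u_def)
    have "real (nat \<lfloor>t * 2 ^ l\<rfloor>) \<le> t * 2 ^ l" "t * 2 ^ l - 1 \<le> real (nat \<lfloor>t * 2 ^ l\<rfloor>)"
      unfolding real by linarith+
    from this[THEN divide_right_mono, of "2 ^ l"]
    show "u l \<le> t" "t - (1/2) ^ l \<le> u l"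
      by (simp_all add: u_def diff_divide_distrib power_divide)
    have "norm (f (u l) - f 0) \<le> a * (\<Sum>r\<le>l. q ^ r)"
      unfolding u_def by (rule partial[OF le])
    also have "(\<Sum>r\<le>l. q ^ r) \<le> (\<Sum>r. q ^ r)"
      using q by (intro sum_le_suminf) auto
    also have "(\<Sum>r. q ^ r) = 1 / (1 - q)" using q by (simp add: suminf_geometric)
    finally show "norm (f (u l) - f 0) \<le> a / (1 - q)" using a by (simp add: mult_left_mono)
  qed
  have "(\<lambda>l. t - (1/2) ^ l) \<longlonglongrightarrow> t - 0" by (intro tendsto_intros) auto
  then have "u \<longlonglongrightarrow> t"
    by (intro tendsto_sandwich[OF _ _ _ tendsto_const, of "\<lambda>l. t - (1/2) ^ l" u]) (use u in auto)
  then have "(\<lambda>l. norm (f (u l) - f 0)) \<longlonglongrightarrow> norm (f t - f 0)"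
    using u t by (intro tendsto_intros continuous_on_tendsto_compose[OF f]) auto
  then show ?thesis
    using u by (intro LIMSEQ_le_const2) auto
qed

text \<open>The second power of \<open>u\<close> matters. In the chaining, \<open>u\<close> is
  proportional to \<open>(2 * q\<^sup>2) ^ l\<close>, so a bound of order \<open>1 / u\<close>,
  summed over \<open>2 ^ l\<close> increments, would leave the divergent ratio
  \<open>1 / q\<^sup>2\<close>.\<close>

lemma exp_minus_le: "0 < u \<Longrightarrow> exp (- u) \<le> 2 / u\<^sup>2" for u :: real
proof -
  assume u: "0 < u"
  have "u\<^sup>2 / 2 \<le> exp u" using exp_lower_Taylor_quadratic[of u] u by simp
  then show ?thesis using u by (simp add: exp_minus field_simps)
qed

text \<open>Chaining on the dyadic blocks \<open>[0, 2^n]\<close>; the ratio \<open>q = 9/10\<close> satisfies \<open>2 q^4 > 1\<close>, which makes the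
  union bound over the \<open>2^l\<close> increments of level \<open>l\<close> summable in \<open>l\<close>.\<close>
lemma std_BM_growth:
  fixes W :: "real \<Rightarrow> 'b \<Rightarrow> real^'p"
  assumes N: "prob_space N" and W: "std_BM N W" and eta: "0 < \<eta>"
  shows "AE \<omega> in N. \<exists>C. \<forall>t\<ge>1. norm (W t \<omega>) \<le> C * t powr (1/2 + \<eta>)"
proof -
  interpret prob_space N by fact
  have [measurable]: "W u \<in> borel_measurable N" if "0 \<le> u" for u using W that by (rule std_BM_measurable)
  define q :: real where "q = 9 / 10"
  \<comment> \<open>\<open>a n\<close> is the growth allowed on the block, \<open>2 ^ n\<close> to
    the power \<open>1/2 + \<eta>\<close>; level \<open>l\<close> of the chaining receives the share
    \<open>a n * q ^ l\<close>.\<close>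
  define a where "a n = (2::real) powr (real n * (1/2 + \<eta>))" for n
  define pt where "pt n l i = real i / 2 ^ l * 2 ^ n" for n l i :: nat
  define E where "E n l i = {\<omega>\<in>space N. a n * q ^ l < norm (W (pt n l (Suc i)) \<omega> - W (pt n l i) \<omega>)}" for n l i
  define B where "B n = (\<Union>l. \<Union>i<2^l. E n l i)" for n
  have a0: "0 \<le> a n" and q0: "0 \<le> q" for n by (simp_all add: a_def q_def)
  have pt0: "0 \<le> pt n l i" for n l i by (simp add: pt_def)
  have [measurable]: "E n l i \<in> sets N" for n l i
    unfolding E_def using pt0 by measurable
  have [measurable]: "B n \<in> sets N" for n unfolding B_def by measurable
  \<comment> \<open>The factor 32 is \<open>2 / (1/4)\<^sup>2\<close>: the exponent \<open>u\<close>
    below carries the factor \<open>1/4\<close> of the tail bound and enters through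
    \<open>2 / u\<^sup>2\<close>.\<close>
  define K where "K = 32 * sqrt 2 ^ CARD('p)"
  have E: "measure N (E n l i) \<le> K * (2 powr (- 4 * \<eta>)) ^ n * (1 / (4 * q ^ 4)) ^ l" for n l i
  proof -
    define u where "u = (2 powr (2 * \<eta>)) ^ n * (2 * q\<^sup>2) ^ l / 4"
    have u: "0 < u" by (simp add: u_def q_def)
    have diff: "pt n l (Suc i) - pt n l i = 2 ^ n / 2 ^ l"
      by (simp add: pt_def algebra_simps add_divide_distrib)
    have an: "(a n)\<^sup>2 = 2 ^ n * (2 powr (2 * \<eta>)) ^ n"
      by (simp add: a_def powr_realpow[symmetric] powr_powr power2_eq_square flip: powr_add)
         (simp add: algebra_simps)
    have "(a n * q ^ l)\<^sup>2 / (4 * (pt n l (Suc i) - pt n l i)) = u"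
      unfolding diff power_mult_distrib an
      by (simp add: u_def power_mult_distrib power_even_eq[symmetric] power_mult[symmetric] mult.commute field_simps)
    moreover have "pt n l i < pt n l (Suc i)"
    proof -
      have "0 < (2::real) ^ n / 2 ^ l" by simp
      with diff show ?thesis by linarith
    qed
    ultimately have "measure N (E n l i) \<le> sqrt 2 ^ CARD('p) * exp (- u)"
      unfolding E_def using pt0[of n l i] std_BM_tail[OF N W, of "pt n l i" "pt n l (Suc i)" "a n * q ^ l"] a0 q0
      by simp
    also have "\<dots> \<le> sqrt 2 ^ CARD('p) * (2 / u\<^sup>2)"
      using exp_minus_le[OF u] by (intro mult_left_mono) auto
    also have "\<dots> = K * (1 / (2 powr (4 * \<eta>)) ^ n) * (1 / (4 * q ^ 4) ^ l)"
    proof -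
      have "(2 powr (2 * \<eta>)) * (2 powr (2 * \<eta>)) = (2::real) powr (4 * \<eta>)"
        by (simp flip: powr_add)
      then have "((2 powr (2 * \<eta>)) ^ n)\<^sup>2 = ((2::real) powr (4 * \<eta>)) ^ n"
        by (simp add: power2_eq_square flip: power_mult_distrib)
      moreover have "(2 * q\<^sup>2)\<^sup>2 = 4 * q ^ 4"
        by (simp add: power_mult_distrib flip: power_mult)
      then have "((2 * q\<^sup>2) ^ l)\<^sup>2 = (4 * q ^ 4) ^ l"
        by (metis power_mult mult.commute)
      ultimately have u2: "u\<^sup>2 = (2 powr (4 * \<eta>)) ^ n * (4 * q ^ 4) ^ l / 16"
        by (simp add: u_def power_divide power_mult_distrib)
      show ?thesis unfolding K_def u2 by simp
    qed
    also have "\<dots> = K * (2 powr (- 4 * \<eta>)) ^ n * (1 / (4 * q ^ 4)) ^ l"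
      using powr_minus_divide[of 2 "4 * \<eta>"] by (simp only: power_one_over minus_mult_left)
    finally show ?thesis .
  qed
  have sumq: "summable (\<lambda>l. (1 / (2 * q ^ 4)) ^ l)"
    by (intro summable_geometric) (simp add: q_def power_divide)
  have B_le: "measure N (B n) \<le> (2 powr (- 4 * \<eta>)) ^ n * (K * (\<Sum>l. (1 / (2 * q ^ 4)) ^ l))" for n
  proof -
    have U: "measure N (\<Union>i<2^l. E n l i) \<le> (K * (2 powr (- 4 * \<eta>)) ^ n) * (1 / (2 * q ^ 4)) ^ l" for l
    proof -
      have "measure N (\<Union>i<2^l. E n l i) \<le> (\<Sum>i<(2::nat)^l. measure N (E n l i))"
        by (intro finite_measure_subadditive_finite) auto
      also have "\<dots> \<le> (\<Sum>i<(2::nat)^l. K * (2 powr (- 4 * \<eta>)) ^ n * (1 / (4 * q ^ 4)) ^ l)"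
        by (intro sum_mono E)
      also have "\<dots> = (K * (2 powr (- 4 * \<eta>)) ^ n) * (2 * (1 / (4 * q ^ 4))) ^ l"
        unfolding power_mult_distrib by simp
      finally show ?thesis by simp
    qed
    have s: "summable (\<lambda>l. (K * (2 powr (- 4 * \<eta>)) ^ n) * (1 / (2 * q ^ 4)) ^ l)"
      using sumq by (rule summable_mult)
    then have s': "summable (\<lambda>l. measure N (\<Union>i<2^l. E n l i))"
      by (rule summable_comparison_test'[where N = 0]) (use U in auto)
    have "measure N (B n) \<le> (\<Sum>l. measure N (\<Union>i<2^l. E n l i))"
      unfolding B_def using s' by (intro finite_measure_subadditive_countably) auto
    also have "\<dots> \<le> (\<Sum>l. (K * (2 powr (- 4 * \<eta>)) ^ n) * (1 / (2 * q ^ 4)) ^ l)"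
      by (intro suminf_le U s s')
    also have "\<dots> = (K * (2 powr (- 4 * \<eta>)) ^ n) * (\<Sum>l. (1 / (2 * q ^ 4)) ^ l)"
      by (rule suminf_mult[OF sumq])
    finally show ?thesis by (simp add: mult_ac)
  qed
  \<comment> \<open>Summability over the blocks is where \<open>\<eta> > 0\<close> enters: the ratio
    is \<open>2 powr (- 4 * \<eta>)\<close>. By Borel-Cantelli almost every path meets only finitely
    many bad blocks.\<close>
  have sumB: "summable (\<lambda>n. (2 powr (- 4 * \<eta>)) ^ n * (K * (\<Sum>l. (1 / (2 * q ^ 4)) ^ l)))"
    using powr_less_mono[of "- 4 * \<eta>" 0 2] eta by (intro summable_mult2 summable_geometric) simp
  have "summable (\<lambda>n. measure N (B n))"
    by (rule summable_comparison_test'[OF sumB, of 0]) (use B_le in \<open>simp only: real_norm_def abs_of_nonneg measure_nonneg\<close>)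
  then have "AE \<omega> in N. eventually (\<lambda>n. \<omega> \<in> space N - B n) sequentially"
    by (intro borel_cantelli_AE1) (auto simp: emeasure_eq_measure)
  then show ?thesis
  proof (rule AE_mp, intro AE_I2 impI)
    fix \<omega> assume om: "\<omega> \<in> space N" and "eventually (\<lambda>n. \<omega> \<in> space N - B n) sequentially"
    then obtain n0 where n0: "\<And>n. n0 \<le> n \<Longrightarrow> \<omega> \<notin> B n"
      by (auto simp: eventually_sequentially)
    have block: "norm (W t \<omega>) \<le> a n / (1 - q)" if n: "n0 \<le> n" and t: "0 \<le> t" "t \<le> 2 ^ n" for n t
    proof -
      define f where "f x = W (x * 2 ^ n) \<omega>" for x
      have "continuous_on {0..1} f"
        unfolding f_def by (intro continuous_on_compose2[OF std_BM_continuous[OF W om]] continuous_intros) auto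
      moreover have "norm (f (real (Suc i) / 2 ^ l) - f (real i / 2 ^ l)) \<le> a n * q ^ l" if "i < 2 ^ l" for i l
        using n0[OF n] that om unfolding B_def E_def f_def pt_def by (auto simp: not_less)
      ultimately have "norm (f (t / 2 ^ n) - f 0) \<le> a n / (1 - q)"
        using t by (intro dyadic_chaining) (auto simp: q_def a_def)
      then show ?thesis using std_BM_zero[OF W om] by (simp add: f_def)
    qed
    \<comment> \<open>A time \<open>t\<close> between \<open>2 ^ n\<close> and
      \<open>2 ^ Suc n\<close> is placed in the block of index \<open>n0 + Suc n\<close>. That block
      is always good, so small times need no separate argument; the price is the factor
      \<open>a (Suc n0)\<close>. The 10 is \<open>1 / (1 - q)\<close>.\<close>
    define C where "C = 10 * a (Suc n0)"
    have "norm (W t \<omega>) \<le> C * t powr (1/2 + \<eta>)" if t: "1 \<le> t" for t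
    proof -
      define n where "n = nat \<lfloor>log 2 t\<rfloor>"
      have l0: "0 \<le> log 2 t" using t by simp
      have "real n \<le> log 2 t" using l0 unfolding n_def by linarith
      then have lo: "2 ^ n \<le> t" using t by (simp add: le_log_iff powr_realpow)
      have "log 2 t \<le> real (Suc n)" using l0 unfolding n_def by linarith
      then have hi: "t \<le> 2 ^ Suc n" using t by (simp add: log_le_iff powr_realpow del: power_Suc of_nat_Suc)
      have "norm (W t \<omega>) \<le> a (n0 + Suc n) / (1 - q)"
      proof (rule block)
        have "(2::real) ^ Suc n \<le> 2 ^ (n0 + Suc n)" by (intro power_increasing) auto
        with hi show "t \<le> 2 ^ (n0 + Suc n)" by (rule order_trans)
      qed (use t in auto)
      also have "\<dots> = C * (2 ^ n) powr (1/2 + \<eta>)"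
        by (simp add: C_def a_def q_def powr_realpow[symmetric] powr_powr flip: powr_add) (simp add: algebra_simps add_divide_distrib)
      also have "\<dots> \<le> C * t powr (1/2 + \<eta>)"
        using lo eta by (intro mult_left_mono powr_mono2) (auto simp: C_def a_def)
      finally show ?thesis .
    qed
    then show "\<exists>C. \<forall>t\<ge>1. norm (W t \<omega>) \<le> C * t powr (1/2 + \<eta>)" by blast
  qed
qed

section \<open>Discretisation of the limit\<close>

text \<open>Because \<open>s \<le> t\<close>, both \<open>t * norm (W s)\<close> and
  \<open>s * norm (W t)\<close> are at most \<open>C * t powr (3/2 + \<eta>)\<close>, which the
  weight cancels exactly.\<close>

lemma AE_sup_bridge_finite:
  fixes W :: "real \<Rightarrow> 'b \<Rightarrow> real^'p"
  assumes N: "prob_space N" and W: "std_BM N W" and eta: "0 < \<eta>"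
  shows "AE \<omega> in N. (SUP st\<in>{(s, t). 1 \<le> s \<and> s \<le> t}.
    ereal (snd st powr (- 3/2 - \<eta>) *
      wnorm (mat 1) (snd st *\<^sub>R W (fst st) \<omega> - fst st *\<^sub>R W (snd st) \<omega>))) < \<infinity>"
  using std_BM_growth[OF assms]
proof (rule AE_mp, intro AE_I2 impI)
  fix \<omega> assume "\<exists>C. \<forall>t\<ge>1. norm (W t \<omega>) \<le> C * t powr (1/2 + \<eta>)"
  then obtain C where C: "\<And>t. 1 \<le> t \<Longrightarrow> norm (W t \<omega>) \<le> C * t powr (1/2 + \<eta>)" by blast
  have C0: "0 \<le> C" using C[of 1] norm_ge_zero[of "W 1 \<omega>"] by (simp del: norm_ge_zero)
  have bound: "t powr (- 3/2 - \<eta>) * wnorm (mat 1) (t *\<^sub>R W s \<omega> - s *\<^sub>R W t \<omega>) \<le> 2 * C / sqrt CARD('p)"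
    if st: "1 \<le> s" "s \<le> t" for s t
  proof -
    have le: "norm (W u \<omega>) \<le> C * t powr (1/2 + \<eta>)" if "1 \<le> u" "u \<le> t" for u
    proof -
      have "C * u powr (1/2 + \<eta>) \<le> C * t powr (1/2 + \<eta>)"
        using that C0 eta by (intro mult_left_mono powr_mono2) auto
      with C[OF that(1)] show ?thesis by linarith
    qed
    have "norm (t *\<^sub>R W s \<omega> - s *\<^sub>R W t \<omega>) \<le> t * norm (W s \<omega>) + s * norm (W t \<omega>)"
      using st norm_triangle_ineq4[of "t *\<^sub>R W s \<omega>" "s *\<^sub>R W t \<omega>"] by simp
    also have "\<dots> \<le> t * (C * t powr (1/2 + \<eta>)) + t * (C * t powr (1/2 + \<eta>))"
      using st C0 by (intro add_mono mult_mono le) auto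
    also have "\<dots> = 2 * C * t powr (3/2 + \<eta>)"
      using st powr_add[of t 1 "1/2 + \<eta>"] by simp
    finally have "t powr (- 3/2 - \<eta>) * norm (t *\<^sub>R W s \<omega> - s *\<^sub>R W t \<omega>)
      \<le> t powr (- 3/2 - \<eta>) * (2 * C * t powr (3/2 + \<eta>))"
      by (intro mult_left_mono) auto
    also have "\<dots> = 2 * C" using st by (simp add: powr_add[symmetric] mult.left_commute)
    finally show ?thesis by (simp add: wnorm_mat_1 divide_right_mono)
  qed
  have "(SUP st\<in>{(s, t). 1 \<le> s \<and> s \<le> t}.
    ereal (snd st powr (- 3/2 - \<eta>) *
      wnorm (mat 1) (snd st *\<^sub>R W (fst st) \<omega> - fst st *\<^sub>R W (snd st) \<omega>))) \<le> ereal (2 * C / sqrt CARD('p))"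
    by (rule SUP_least) (use bound in auto)
  also have "\<dots> < \<infinity>" by simp
  finally show "(SUP st\<in>{(s, t). 1 \<le> s \<and> s \<le> t}.
    ereal (snd st powr (- 3/2 - \<eta>) *
      wnorm (mat 1) (snd st *\<^sub>R W (fst st) \<omega> - fst st *\<^sub>R W (snd st) \<omega>))) < \<infinity>" .
qed

lemma grid_approx:
  fixes s :: real
  assumes "1 \<le> s"
  shows "(\<lambda>m. real (nat \<lceil>real m * s\<rceil>) / real m) \<longlonglongrightarrow> s" "m \<le> nat \<lceil>real m * s\<rceil>"
proof -
  have up: "real (nat \<lceil>real m * s\<rceil>) \<le> real m * s + 1" and lo: "real m * s \<le> real (nat \<lceil>real m * s\<rceil>)" for m
    using assms of_nat_ceiling mult_nonneg_nonneg[of "real m" s] by linarith+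
  have "real m * 1 \<le> real m * s" using assms by (intro mult_left_mono) auto
  with lo[of m] show "m \<le> nat \<lceil>real m * s\<rceil>" by linarith
  show "(\<lambda>m. real (nat \<lceil>real m * s\<rceil>) / real m) \<longlonglongrightarrow> s"
  proof (rule tendsto_sandwich[of "\<lambda>_. s" _ _ "\<lambda>m. s + 1 / real m"])
    show "\<forall>\<^sub>F m in sequentially. s \<le> real (nat \<lceil>real m * s\<rceil>) / real m"
      using eventually_gt_at_top[of 0] by eventually_elim (use lo in \<open>simp add: field_simps\<close>)
    show "\<forall>\<^sub>F m in sequentially. real (nat \<lceil>real m * s\<rceil>) / real m \<le> s + 1 / real m"
      using eventually_gt_at_top[of 0] by eventually_elim (use up in \<open>simp add: field_simps\<close>)
    show "(\<lambda>m. s + 1 / real m) \<longlonglongrightarrow> s"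
      using tendsto_add[OF tendsto_const lim_1_over_n] by simp
  qed simp
qed

text \<open>The indicators of the grid events converge pointwise, so the event on the right, an uncountable
  intersection, is measurable.\<close>
lemma measure_grid_sup:
  fixes h :: "real \<Rightarrow> real \<Rightarrow> 'b \<Rightarrow> real"
  assumes N: "prob_space N"
    and meas: "\<And>s t. 1 \<le> s \<Longrightarrow> s \<le> t \<Longrightarrow> h s t \<in> borel_measurable N"
    and cont: "\<And>\<omega>. \<omega> \<in> space N \<Longrightarrow> continuous_on {(s, t). 1 \<le> s \<and> s \<le> t} (\<lambda>(s, t). h s t \<omega>)"
    and nonneg: "\<And>s t \<omega>. 0 \<le> h s t \<omega>" and diag: "\<And>s \<omega>. h s s \<omega> = 0"
  shows "(\<lambda>m. measure N {\<omega>\<in>space N. \<forall>k>m. \<forall>j\<in>{m..<k}. h (real j / real m) (real k / real m) \<omega> \<le> y})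
    \<longlonglongrightarrow> measure N {\<omega>\<in>space N. \<forall>s t. 1 \<le> s \<longrightarrow> s \<le> t \<longrightarrow> h s t \<omega> \<le> y}"
proof -
  interpret prob_space N by fact
  define E where "E = {\<omega>\<in>space N. \<forall>s t. 1 \<le> s \<longrightarrow> s \<le> t \<longrightarrow> h s t \<omega> \<le> y}"
  define G where "G m = {\<omega>\<in>space N. \<forall>k>m. \<forall>j\<in>{m..<k}. h (real j / real m) (real k / real m) \<omega> \<le> y}" for m
  \<comment> \<open>Index 0 is skipped: division by zero yields 0, so the grid points for
    \<open>m = 0\<close> lie outside the domain on which \<open>h\<close> is known to be measurable.
    The shift is undone at the end by \<open>LIMSEQ_imp_Suc\<close>.\<close>
  have G[measurable]: "G (Suc m) \<in> sets N" for m
  proof -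
    have "G (Suc m) = {\<omega>\<in>space N. \<forall>k j. Suc m < k \<and> j \<in> {Suc m..<k} \<longrightarrow> h (real j / real (Suc m)) (real k / real (Suc m)) \<omega> \<le> y}"
      by (auto simp: G_def)
    also have "\<dots> \<in> sets N"
    proof (intro sets.sets_Collect_countable_All)
      fix k j
      have "h (real j / real (Suc m)) (real k / real (Suc m)) \<in> borel_measurable N" if "Suc m < k" "j \<in> {Suc m..<k}"
        using that by (intro meas) (auto intro!: divide_right_mono simp: le_divide_eq_1_pos simp del: of_nat_Suc)
      then show "{\<omega>\<in>space N. Suc m < k \<and> j \<in> {Suc m..<k} \<longrightarrow> h (real j / real (Suc m)) (real k / real (Suc m)) \<omega> \<le> y} \<in> sets N"
        by (cases "Suc m < k \<and> j \<in> {Suc m..<k}") (simp_all add: borel_measurable_iff_le)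
    qed
    finally show ?thesis .
  qed
  have lim: "(\<lambda>m. indicat_real (G (Suc m)) \<omega>) \<longlonglongrightarrow> indicator E \<omega>" if om: "\<omega> \<in> space N" for \<omega>
  proof (cases "\<omega> \<in> E")
    case True
    then have "h (real j / real (Suc m)) (real k / real (Suc m)) \<omega> \<le> y" if "Suc m \<le> j" "j < k" for m j k
      using that by (simp add: E_def le_divide_eq_1_pos divide_right_mono del: of_nat_Suc)
    with om have "\<omega> \<in> G (Suc m)" for m by (simp add: G_def)
    with True show ?thesis by simp
  next
    case False
    then obtain s t where st: "1 \<le> s" "s \<le> t" "y < h s t \<omega>"
      using om by (auto simp: E_def not_le)
    \<comment> \<open>The grid has only pairs \<open>j < k\<close>, so a violating pair off the
      diagonal is needed. A violation on the diagonal forces \<open>y < 0\<close>, and then any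
      other pair violates too.\<close>
    obtain s t where st: "1 \<le> s" "s < t" "y < h s t \<omega>"
    proof (cases "s = t")
      case True
      with st diag have "y < 0" by simp
      then show thesis using that[of 1 2] nonneg[of 1 2 \<omega>] by simp
    qed (use that[of s t] st in simp)
    define u v where "u m = nat \<lceil>real m * s\<rceil>" and "v m = nat \<lceil>real m * t\<rceil>" for m
    have u: "(\<lambda>m. real (u m) / real m) \<longlonglongrightarrow> s" "m \<le> u m" for m
      using grid_approx[of s] st by (simp_all add: u_def)
    have v: "(\<lambda>m. real (v m) / real m) \<longlonglongrightarrow> t" "m \<le> v m" for m
      using grid_approx[of t] st by (simp_all add: v_def)
    have "((\<lambda>m. (case (real (u m) / real m, real (v m) / real m) of (s, t) \<Rightarrow> h s t \<omega>)) \<longlongrightarrow> (case (s, t) of (s, t) \<Rightarrow> h s t \<omega>)) sequentially"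
    proof (rule continuous_on_tendsto_compose[OF cont[OF om]])
      show "(\<lambda>m. (real (u m) / real m, real (v m) / real m)) \<longlonglongrightarrow> (s, t)"
        by (intro tendsto_Pair u v)
      show "\<forall>\<^sub>F m in sequentially. (real (u m) / real m, real (v m) / real m) \<in> {(s, t). 1 \<le> s \<and> s \<le> t}"
        using eventually_gt_at_top[of 0]
      proof eventually_elim
        case (elim m)
        have "u m \<le> v m" unfolding u_def v_def using st
          by (intro nat_mono ceiling_mono mult_left_mono) auto
        then show ?case using elim u(2)[of m] by (simp add: field_simps)
      qed
    qed (use st in auto)
    then have "\<forall>\<^sub>F m in sequentially. y < h (real (u m) / real m) (real (v m) / real m) \<omega>"
      using st by (auto dest: order_tendstoD(1))
    \<comment> \<open>The midpoint separates the two approximations and makes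
      \<open>u m < v m\<close> strict.\<close>
    moreover have "\<forall>\<^sub>F m in sequentially. real (u m) / real m < (s + t) / 2"
      using u(1) st by (intro order_tendstoD(2)) auto
    moreover have "\<forall>\<^sub>F m in sequentially. (s + t) / 2 < real (v m) / real m"
      using v(1) st by (intro order_tendstoD(1)) auto
    ultimately have "\<forall>\<^sub>F m in sequentially. \<omega> \<notin> G m"
      using eventually_gt_at_top[of 0]
    proof eventually_elim
      case (elim m)
      then have "real (u m) / real m < real (v m) / real m" by linarith
      then have "u m < v m" using elim by (simp add: divide_less_cancel)
      then show ?case using elim u(2)[of m]
        by (auto simp: G_def not_le intro!: exI[of _ "v m"] bexI[of _ "u m"])
    qed
    then have "\<forall>\<^sub>F m in sequentially. indicat_real (G (Suc m)) \<omega> = indicator E \<omega>"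
      using False by (subst eventually_sequentially_Suc) (auto elim: eventually_mono)
    then show ?thesis by (rule tendsto_eventually)
  qed
  have "indicat_real E \<in> borel_measurable N"
    by (rule borel_measurable_LIMSEQ_real[OF lim]) auto
  then have E: "E \<in> sets N"
    by (subst (asm) borel_measurable_indicator_iff) (auto simp: E_def Int_def conj_commute cong: conj_cong)
  have "(\<lambda>m. integral\<^sup>L N (indicat_real (G (Suc m)))) \<longlonglongrightarrow> integral\<^sup>L N (indicat_real E)"
    by (rule integral_dominated_convergence[where w = "\<lambda>_. 1"]) (use E lim in auto)
  then have "(\<lambda>m. measure N (G (Suc m))) \<longlonglongrightarrow> measure N E"
    using E sets.sets_into_space[OF G] sets.sets_into_space[OF E] by (simp add: Int_absorb2)
  then show ?thesis
    unfolding E_def G_def by (rule LIMSEQ_imp_Suc)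
qed

section \<open>The law of the coupled path\<close>

text \<open>Independence is a condition on finite index sets, each contained in an initial segment.
  It lifts the finitely many increments granted by \<open>std_BM\<close> to a whole
  sequence.\<close>

lemma (in prob_space) indep_vars_natI:
  assumes "\<And>n. indep_vars M' X {..<n::nat}"
  shows "indep_vars M' X UNIV"
proof -
  have "random_variable (M' i) (X i)" for i
    using assms[of "Suc i"] by (auto simp: indep_vars_def)
  moreover have "indep_sets (\<lambda>i. {X i -` A \<inter> space M | A. A \<in> sets (M' i)}) J" if "finite J" for J
  proof -
    obtain n where "J \<subseteq> {..<n}" using \<open>finite J\<close> finite_nat_iff_bounded by blast
    then show ?thesis
      using assms[of n] by (auto simp: indep_vars_def2 intro: indep_sets_mono_index)
  qed
  ultimately show ?thesis
    by (auto simp: indep_vars_def2 intro: indep_sets_finite_index_sets[THEN iffD2])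
qed

lemma std_BM_indep_increments:
  fixes W :: "real \<Rightarrow> 'b \<Rightarrow> real^'p"
  assumes N: "prob_space N" and W: "std_BM N W" and ts: "0 \<le> ts 0" "\<And>i. ts i < ts (Suc i)"
  shows "prob_space.indep_vars N (\<lambda>_. borel) (\<lambda>i \<omega>. W (ts (Suc i)) \<omega> - W (ts i) \<omega>) UNIV"
proof -
  interpret prob_space N by fact
  show ?thesis
    by (rule indep_vars_natI) (use W ts in \<open>simp add: std_BM_def\<close>)
qed

text \<open>The condition \<open>step\<close> covers both uses at once: unit time steps with
  \<open>c = 1\<close> for the coupled path, and steps \<open>1/m\<close> with
  \<open>c = sqrt m\<close> for the rescaled path. Both yield literally the same product
  measure.\<close>

lemma std_BM_increment_law:
  fixes W :: "real \<Rightarrow> 'b \<Rightarrow> real^'p"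
  assumes N: "prob_space N" and W: "std_BM N W" and ts: "0 \<le> ts 0" "\<And>i. ts i < ts (Suc i)"
    and c: "0 < c" and step: "\<And>i. c\<^sup>2 * (ts (Suc i) - ts i) = 1"
  shows "distr N (PiM UNIV (\<lambda>_. borel)) (\<lambda>\<omega> i::nat. c *\<^sub>R (W (ts (Suc i)) \<omega> - W (ts i) \<omega>))
    = PiM UNIV (\<lambda>_. gaussian 1)"
proof -
  interpret prob_space N by fact
  have ts0: "0 \<le> ts i" for i
    using ts(1) less_imp_le[OF ts(2)] by (induction i) (auto intro: order_trans)
  have [measurable]: "W (ts i) \<in> borel_measurable N" for i
    using W ts0 by (rule std_BM_measurable)
  let ?X = "\<lambda>i \<omega>. c *\<^sub>R (W (ts (Suc i)) \<omega> - W (ts i) \<omega>)"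
  have "indep_vars (\<lambda>_. borel) ?X UNIV"
    using indep_vars_compose2[OF std_BM_indep_increments[OF N W ts], of "\<lambda>_ x. c *\<^sub>R x" "\<lambda>_. borel"] by simp
  then have "distr N (PiM UNIV (\<lambda>_. borel)) (\<lambda>\<omega>. \<lambda>i\<in>UNIV. ?X i \<omega>) = PiM UNIV (\<lambda>i. distr N borel (?X i))"
    by (subst (asm) indep_vars_iff_distr_eq_PiM') auto
  moreover have "distr N borel (?X i) = gaussian 1" for i
  proof -
    have "distr N borel (?X i) = distr (distr N borel (\<lambda>\<omega>. W (ts (Suc i)) \<omega> - W (ts i) \<omega>)) borel ((*\<^sub>R) c)"
      by (subst distr_distr) (auto simp: comp_def)
    also have "\<dots> = gaussian (c\<^sup>2 * (ts (Suc i) - ts i))"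
      by (simp add: std_BM_increment[OF W ts0 ts(2)] gaussian_scale c ts(2))
    finally show ?thesis by (simp add: step)
  qed
  ultimately show ?thesis by (simp add: restrict_UNIV)
qed

lemma std_BM_scaled_law:
  fixes W :: "real \<Rightarrow> 'b \<Rightarrow> real^'p"
  assumes N: "prob_space N" and W: "std_BM N W" and t: "0 < t" and c: "0 < c"
  shows "distr N borel (\<lambda>\<omega>. c *\<^sub>R W t \<omega>) = gaussian (c\<^sup>2 * t)"
proof -
  have [measurable]: "W t \<in> borel_measurable N" "W 0 \<in> borel_measurable N"
    using t by (auto intro!: std_BM_measurable[OF W])
  have "distr N borel (\<lambda>\<omega>. c *\<^sub>R W t \<omega>) = distr (distr N borel (\<lambda>\<omega>. W t \<omega> - W 0 \<omega>)) borel ((*\<^sub>R) c)"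
    by (subst distr_distr) (auto intro!: distr_cong simp: std_BM_zero[OF W])
  also have "\<dots> = gaussian (c\<^sup>2 * t)"
    by (simp add: std_BM_increment[OF W, of 0 t] gaussian_scale c t)
  finally show ?thesis .
qed

text \<open>Library independence of two random variables requires a common value type; this is why the single
  vector \<open>V2 m\<close> appears as a function on \<open>{0}\<close>.\<close>
lemma glued_BM_law:
  fixes V1 V2 :: "real \<Rightarrow> 'a \<Rightarrow> real^'p"
  assumes M: "prob_space M" and V1: "std_BM M V1" and V2: "std_BM M V2" and m: "0 < m"
    and ind: "prob_space.indep_var M
           (PiM {0..} (\<lambda>_. borel)) (\<lambda>\<omega>. \<lambda>t\<in>{0..}. V1 t \<omega>)
           (PiM {0..} (\<lambda>_. borel)) (\<lambda>\<omega>. \<lambda>t\<in>{0..}. V2 t \<omega>)"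
  shows "distr M (PiM UNIV (\<lambda>_. borel) \<Otimes>\<^sub>M PiM {0} (\<lambda>_. borel))
      (\<lambda>\<omega>. (\<lambda>i::nat. V1 (real (Suc i)) \<omega> - V1 (real i) \<omega>, \<lambda>i\<in>{0::nat}. V2 m \<omega>)) = PiM UNIV (\<lambda>_. gaussian 1) \<Otimes>\<^sub>M distr (gaussian m) (PiM {0} (\<lambda>_. borel)) (\<lambda>x. \<lambda>i\<in>{0}. x)"
proof -
  interpret prob_space M by fact
  have "indep_var (PiM UNIV (\<lambda>_. borel)) ((\<lambda>f i::nat. f (real (Suc i)) - f (real i)) \<circ> (\<lambda>\<omega>. \<lambda>t\<in>{0..}. V1 t \<omega>))
    (PiM {0} (\<lambda>_. borel)) ((\<lambda>f. \<lambda>i\<in>{0}. f m) \<circ> (\<lambda>\<omega>. \<lambda>t\<in>{0..}. V2 t \<omega>))"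
  proof (rule indep_var_compose[OF ind])
    show "(\<lambda>f i::nat. f (real (Suc i)) - f (real i)) \<in> measurable (PiM {0..} (\<lambda>_. borel :: (real^'p) measure)) (PiM UNIV (\<lambda>_. borel))"
      by (rule measurable_PiM_single') (auto intro!: borel_measurable_diff measurable_component_singleton)
    show "(\<lambda>f. \<lambda>i\<in>{0::nat}. f m) \<in> measurable (PiM {0..} (\<lambda>_. borel :: (real^'p) measure)) (PiM {0} (\<lambda>_. borel))"
      using m by (intro measurable_restrict measurable_component_singleton) auto
  qed
  then have "indep_var (PiM UNIV (\<lambda>_. borel)) (\<lambda>\<omega> i::nat. V1 (real (Suc i)) \<omega> - V1 (real i) \<omega>) (PiM {0::nat} (\<lambda>_. borel)) (\<lambda>\<omega>. \<lambda>i\<in>{0}. V2 m \<omega>)"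
    using m by (simp add: comp_def)
  then have "distr M (PiM UNIV (\<lambda>_. borel)) (\<lambda>\<omega> i::nat. V1 (real (Suc i)) \<omega> - V1 (real i) \<omega>) \<Otimes>\<^sub>M distr M (PiM {0} (\<lambda>_. borel)) (\<lambda>\<omega>. \<lambda>i\<in>{0::nat}. V2 m \<omega>)
    = distr M (PiM UNIV (\<lambda>_. borel) \<Otimes>\<^sub>M PiM {0} (\<lambda>_. borel)) (\<lambda>\<omega>. (\<lambda>i. V1 (real (Suc i)) \<omega> - V1 (real i) \<omega>, \<lambda>i\<in>{0::nat}. V2 m \<omega>))"
    unfolding indep_var_distribution_eq by blast
  moreover have "distr M (PiM UNIV (\<lambda>_. borel)) (\<lambda>\<omega> i::nat. V1 (real (Suc i)) \<omega> - V1 (real i) \<omega>) = PiM UNIV (\<lambda>_. gaussian 1)"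
    using std_BM_increment_law[OF M V1, of real 1] by simp
  moreover have "distr M (PiM {0} (\<lambda>_. borel)) (\<lambda>\<omega>. \<lambda>i\<in>{0::nat}. V2 m \<omega>) = distr (gaussian m) (PiM {0} (\<lambda>_. borel)) (\<lambda>x. \<lambda>i\<in>{0}. x)"
  proof -
    have [measurable]: "V2 m \<in> borel_measurable M" using m by (intro std_BM_measurable[OF V2]) simp
    have "gaussian m = distr M borel (V2 m)"
      using std_BM_scaled_law[OF M V2 m, of 1] by simp
    then show ?thesis by (simp add: distr_distr comp_def)
  qed
  ultimately show ?thesis by simp
qed

text \<open>The right-hand side is the one of \<open>glued_BM_law\<close>: Brownian scaling matches
  the value at time 1 with the second motion at time \<open>m\<close>, and later increments with
  unit increments of the first.\<close>

lemma scaled_BM_law: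
  fixes W :: "real \<Rightarrow> 'b \<Rightarrow> real^'p"
  assumes N: "prob_space N" and W: "std_BM N W" and m: "0 < m"
  shows "distr N (PiM UNIV (\<lambda>_. borel) \<Otimes>\<^sub>M PiM {0} (\<lambda>_. borel))
      (\<lambda>\<omega>. (\<lambda>i::nat. sqrt m *\<^sub>R (W (1 + real (Suc i) / m) \<omega> - W (1 + real i / m) \<omega>), \<lambda>i\<in>{0::nat}. sqrt m *\<^sub>R W 1 \<omega>))
    = PiM UNIV (\<lambda>_. gaussian 1) \<Otimes>\<^sub>M distr (gaussian m) (PiM {0} (\<lambda>_. borel)) (\<lambda>x. \<lambda>i\<in>{0}. x)"
proof -
  interpret prob_space N by fact
  \<comment> \<open>The time grid is \<open>0, 1, 1 + 1/m, 1 + 2/m, ...\<close>. Its increment of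
    index 0 is \<open>W 1 - W 0\<close>, and those from index 1 on form the path after time 1;
    independence comes from splitting the index set there.\<close>
  define ts where "ts i = (case i of 0 \<Rightarrow> 0 | Suc k \<Rightarrow> 1 + real k / m)" for i
  have ts: "0 \<le> ts 0" "ts i < ts (Suc i)" for i
    using m by (auto simp: ts_def divide_strict_right_mono add_pos_nonneg split: nat.split)
  let ?X = "\<lambda>i \<omega>. W (ts (Suc i)) \<omega> - W (ts i) \<omega>"
  have "indep_var (PiM UNIV (\<lambda>_. borel)) ((\<lambda>f i. sqrt m *\<^sub>R f (Suc i)) \<circ> (\<lambda>\<omega>. restrict (\<lambda>i. ?X i \<omega>) {1..}))
    (PiM {0} (\<lambda>_. borel)) ((\<lambda>f. \<lambda>i\<in>{0::nat}. sqrt m *\<^sub>R f 0) \<circ> (\<lambda>\<omega>. restrict (\<lambda>i. ?X i \<omega>) {0}))"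
  proof (rule indep_var_compose[OF indep_var_restrict[OF std_BM_indep_increments[OF N W ts]]])
    show "(\<lambda>f. \<lambda>i\<in>{0::nat}. sqrt m *\<^sub>R f 0) \<in> measurable (PiM {0::nat} (\<lambda>_. borel :: (real^'p) measure)) (PiM {0} (\<lambda>_. borel))"
      by (intro measurable_restrict borel_measurable_scaleR borel_measurable_const measurable_component_singleton) auto
    show "(\<lambda>f i. sqrt m *\<^sub>R f (Suc i)) \<in> measurable (PiM {1::nat..} (\<lambda>_. borel :: (real^'p) measure)) (PiM UNIV (\<lambda>_. borel))"
      by (rule measurable_PiM_single') (auto intro!: borel_measurable_scaleR measurable_component_singleton)
  qed auto
  then have "indep_var (PiM UNIV (\<lambda>_. borel))
      (\<lambda>\<omega> i::nat. sqrt m *\<^sub>R (W (1 + real (Suc i) / m) \<omega> - W (1 + real i / m) \<omega>))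
      (PiM {0} (\<lambda>_. borel)) (\<lambda>\<omega>. \<lambda>i\<in>{0::nat}. sqrt m *\<^sub>R (W 1 \<omega> - W 0 \<omega>))"
    by (simp add: comp_def ts_def cong: restrict_cong)
  note this[unfolded indep_var_distribution_eq]
  then have "distr N (PiM UNIV (\<lambda>_. borel)) (\<lambda>\<omega> i::nat. sqrt m *\<^sub>R (W (1 + real (Suc i) / m) \<omega> - W (1 + real i / m) \<omega>))
        \<Otimes>\<^sub>M distr N (PiM {0} (\<lambda>_. borel)) (\<lambda>\<omega>. \<lambda>i\<in>{0::nat}. sqrt m *\<^sub>R (W 1 \<omega> - W 0 \<omega>))
    = distr N (PiM UNIV (\<lambda>_. borel) \<Otimes>\<^sub>M PiM {0} (\<lambda>_. borel))
      (\<lambda>\<omega>. (\<lambda>i::nat. sqrt m *\<^sub>R (W (1 + real (Suc i) / m) \<omega> - W (1 + real i / m) \<omega>), \<lambda>i\<in>{0::nat}. sqrt m *\<^sub>R (W 1 \<omega> - W 0 \<omega>)))"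
    by blast
  moreover have "distr N (PiM UNIV (\<lambda>_. borel)) (\<lambda>\<omega> i::nat. sqrt m *\<^sub>R (W (1 + real (Suc i) / m) \<omega> - W (1 + real i / m) \<omega>)) = PiM UNIV (\<lambda>_. gaussian 1)"
    using m by (intro std_BM_increment_law[OF N W]) (auto simp: field_simps)
  moreover have "distr N (PiM {0} (\<lambda>_. borel)) (\<lambda>\<omega>. \<lambda>i\<in>{0::nat}. sqrt m *\<^sub>R (W 1 \<omega> - W 0 \<omega>))
      = distr (gaussian m) (PiM {0} (\<lambda>_. borel)) (\<lambda>x. \<lambda>i\<in>{0}. x)"
  proof -
    have [measurable]: "W 1 \<in> borel_measurable N" by (rule std_BM_measurable[OF W]) simp
    have "gaussian m = distr N borel (\<lambda>\<omega>. sqrt m *\<^sub>R W 1 \<omega>)"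
      using std_BM_scaled_law[OF N W, of 1 "sqrt m"] m by simp
    then show ?thesis
      by (simp add: distr_distr comp_def std_BM_zero[OF W] cong: distr_cong)
  qed
  ultimately show ?thesis
    by (simp add: std_BM_zero[OF W] cong: distr_cong)
qed

text \<open>Both events are preimages of one measurable set \<open>A\<close> of starting values and
  increment sequences, under maps with equal laws.\<close>

lemma measure_glued_eq_scaled:
  fixes V1 V2 :: "real \<Rightarrow> 'a \<Rightarrow> real^'p" and W :: "real \<Rightarrow> 'b \<Rightarrow> real^'p" and m :: nat
  assumes M: "prob_space M" and V1: "std_BM M V1" and V2: "std_BM M V2" and m: "0 < m"
    and ind: "prob_space.indep_var M
           (PiM {0..} (\<lambda>_. borel)) (\<lambda>\<omega>. \<lambda>t\<in>{0..}. V1 t \<omega>)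
           (PiM {0..} (\<lambda>_. borel)) (\<lambda>\<omega>. \<lambda>t\<in>{0..}. V2 t \<omega>)"
    and N: "prob_space N" and W: "std_BM N W"
    and g: "\<And>j k. g j k \<in> borel_measurable (borel \<Otimes>\<^sub>M borel)"
  shows "measure M {\<omega>\<in>space M. \<forall>k>m. \<forall>j\<in>{m..<k}. g j k (V2 m \<omega> + V1 (real (j - m)) \<omega>, V2 m \<omega> + V1 (real (k - m)) \<omega>) \<le> (y::real)}
    = measure N {\<omega>\<in>space N. \<forall>k>m. \<forall>j\<in>{m..<k}. g j k (sqrt m *\<^sub>R W (real j / real m) \<omega>, sqrt m *\<^sub>R W (real k / real m) \<omega>) \<le> y}"
proof -
  have [measurable]: "V1 u \<in> borel_measurable M" "V2 u \<in> borel_measurable M" "W u \<in> borel_measurable N" if "0 \<le> u" for u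
    using V1 V2 W that by (auto intro: std_BM_measurable)
  let ?Q = "PiM UNIV (\<lambda>_::nat. borel :: (real^'p) measure) \<Otimes>\<^sub>M PiM {0::nat} (\<lambda>_. borel :: (real^'p) measure)"
  \<comment> \<open>Rebuilds the position at index \<open>j\<close> from the starting value and the
    increments, by telescoping; \<open>snd z 0\<close> is the value at index
    \<open>m\<close>.\<close>
  define path where "path j z = snd z 0 + (\<Sum>l<j - m. fst z l)" for j and z :: "(nat \<Rightarrow> real^'p) \<times> (nat \<Rightarrow> real^'p)"
  have [measurable]: "path j \<in> borel_measurable ?Q" for j
    unfolding path_def by measurable
  have [measurable]: "(\<lambda>z. g j k (path j z, path k z)) \<in> borel_measurable ?Q" for j k
    by (rule measurable_compose[OF _ g]) measurable
  define A where "A = {z \<in> space ?Q. \<forall>k. m < k \<longrightarrow> (\<forall>j. j \<in> {m..<k} \<longrightarrow> g j k (path j z, path k z) \<le> y)}"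
  have A: "A \<in> sets ?Q" unfolding A_def by measurable
  let ?v = "\<lambda>\<omega>. (\<lambda>i::nat. V1 (real (Suc i)) \<omega> - V1 (real i) \<omega>, \<lambda>i\<in>{0::nat}. V2 m \<omega>)"
  let ?w = "\<lambda>\<omega>. (\<lambda>i::nat. sqrt m *\<^sub>R (W (1 + real (Suc i) / m) \<omega> - W (1 + real i / m) \<omega>), \<lambda>i\<in>{0::nat}. sqrt m *\<^sub>R W 1 \<omega>)"
  have v: "?v \<in> measurable M ?Q"
    by (intro measurable_Pair measurable_PiM_single' measurable_restrict) (auto simp del: of_nat_Suc)
  have w: "?w \<in> measurable N ?Q"
    by (intro measurable_Pair measurable_PiM_single' measurable_restrict borel_measurable_scaleR borel_measurable_diff
        borel_measurable_const std_BM_measurable[OF W]) simp_all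
  have path_v: "path j (?v \<omega>) = V2 m \<omega> + V1 (real (j - m)) \<omega>" if "\<omega> \<in> space M" for j \<omega>
    using std_BM_zero[OF V1 that] sum_lessThan_telescope[of "\<lambda>l. V1 (real l) \<omega>"] by (simp add: path_def)
  have path_w: "path j (?w \<omega>) = sqrt m *\<^sub>R W (real j / real m) \<omega>" if "m \<le> j" for j \<omega>
  proof -
    have "path j (?w \<omega>) = sqrt m *\<^sub>R W (1 + real (j - m) / m) \<omega>"
      using sum_lessThan_telescope[of "\<lambda>l. sqrt m *\<^sub>R W (1 + real l / m) \<omega>" "j - m"]
      by (simp add: path_def scaleR_diff_right del: of_nat_Suc)
    also have "1 + real (j - m) / m = real j / real m"
      using that m by (simp add: of_nat_diff field_simps)
    finally show ?thesis .
  qed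
  have "measure M {\<omega>\<in>space M. \<forall>k>m. \<forall>j\<in>{m..<k}. g j k (V2 m \<omega> + V1 (real (j - m)) \<omega>, V2 m \<omega> + V1 (real (k - m)) \<omega>) \<le> y}
    = measure M (?v -` A \<inter> space M)"
    using measurable_space[OF v] by (intro arg_cong[where f = "measure M"]) (auto simp: A_def path_v simp del: of_nat_Suc of_nat_diff)
  also have "\<dots> = measure (distr M ?Q ?v) A" using v A by (simp add: measure_distr)
  also have "distr M ?Q ?v = distr N ?Q ?w"
    using m by (simp only: glued_BM_law[OF M V1 V2 _ ind] scaled_BM_law[OF N W] of_nat_0_less_iff)
  also have "measure (distr N ?Q ?w) A = measure N (?w -` A \<inter> space N)" using w A by (simp add: measure_distr)
  also have "?w -` A \<inter> space N = {\<omega>\<in>space N. \<forall>k>m. \<forall>j\<in>{m..<k}. g j k (sqrt m *\<^sub>R W (real j / real m) \<omega>, sqrt m *\<^sub>R W (real k / real m) \<omega>) \<le> y}"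
    using measurable_space[OF w] by (auto simp: A_def path_w simp del: of_nat_Suc of_nat_diff)
  finally show ?thesis .
qed

section \<open>Approximation of the statistic\<close>

lemma borel_measurable_vecI:
  fixes f :: "'a \<Rightarrow> 'b::euclidean_space^'n"
  assumes "\<And>i. (\<lambda>x. f x $ i) \<in> borel_measurable M"
  shows "f \<in> borel_measurable M"
  unfolding borel_measurable_euclidean_space[of f]
proof
  fix b :: "'b^'n" assume "b \<in> Basis"
  then obtain i u where "b = axis i u" "u \<in> Basis" by (auto simp: Basis_vec_def)
  then show "(\<lambda>x. f x \<bullet> b) \<in> borel_measurable M"
    using assms[of i] by (simp add: inner_axis)
qed

lemma borel_measurable_indic_vec:
  assumes [measurable]: "X i \<in> borel_measurable M"
  shows "indic_vec X pts i \<in> borel_measurable M"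
  by (rule borel_measurable_vecI) (simp add: indic_vec_def)

lemma borel_measurable_wnorm[measurable]:
  fixes f :: "'a \<Rightarrow> real^'p^'p"
  assumes "f \<in> borel_measurable M" "g \<in> borel_measurable M"
  shows "(\<lambda>x. wnorm (f x) (g x)) \<in> borel_measurable M"
proof -
  have "continuous_on UNIV (\<lambda>(A :: real^'p^'p, y). wnorm A y)"
    unfolding wnorm_def matrix_vector_mult_def case_prod_beta
    by (auto intro!: continuous_intros)
  from borel_measurable_continuous_on[OF this borel_measurable_Pair[OF assms]]
  show ?thesis by simp
qed

lemma borel_measurable_matrix_inv:
  fixes f :: "'a \<Rightarrow> real^'n^'n"
  assumes f: "f \<in> borel_measurable M" and inv: "\<And>x. x \<in> space M \<Longrightarrow> invertible (f x)"
  shows "(\<lambda>x. matrix_inv (f x)) \<in> borel_measurable M"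
proof -
  have "(\<lambda>A. if A \<in> {A. invertible A} then matrix_inv A else 0 :: real^'n^'n) \<in> borel_measurable borel"
    by (rule borel_measurable_continuous_on_if)
      (auto intro: continuous_on_matrix_inv borel_open open_invertible)
  from measurable_compose[OF f this] show ?thesis
    by (rule measurable_cong[THEN iffD1, rotated]) (simp add: inv)
qed

lemma wnorm_mat_1_diff: "\<bar>wnorm (mat 1) x - wnorm (mat 1) y\<bar> \<le> norm (x - y :: real^'p) / sqrt CARD('p)"
  using norm_triangle_ineq3[of x y]
  by (simp add: wnorm_mat_1 divide_right_mono abs_divide flip: diff_divide_distrib)

text \<open>Centring by any \<open>\<mu>\<close> is harmless, since its contributions to
  \<open>k S_j\<close> and \<open>j S_k\<close> are equal and cancel. Stated as an equivalence of
  inequalities, it replaces the maximum by a quantifier, which matches the shape of the Gaussian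
  event.\<close>

lemma detector_le_iff:
  fixes Y :: "nat \<Rightarrow> 'a \<Rightarrow> real^'p" and \<mu> :: "real^'p" and \<omega> :: 'a
  assumes m: "0 < m" "m < k" and a: "0 < a"
  defines "S \<equiv> \<lambda>j. \<Sum>i\<in>{1..j}. Y i \<omega> - \<mu>"
  shows "a * detector Y Sm m k \<omega> \<le> x \<longleftrightarrow>
    (\<forall>j\<in>{m..<k}. a / real m powr (3/2) * wnorm (matrix_inv (Sm m \<omega>)) (real k *\<^sub>R S j - real j *\<^sub>R S k) \<le> x)"
proof -
  let ?A = "matrix_inv (Sm m \<omega>)"
  have summand: "real j * real (k - j) / real m powr (3/2) * wnorm ?A (ybar Y 1 j \<omega> - ybar Y (j + 1) k \<omega>)
    = wnorm ?A (real k *\<^sub>R S j - real j *\<^sub>R S k) / real m powr (3/2)" if j: "j \<in> {m..<k}" for j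
  proof -
    define P where "P j = (\<Sum>i\<in>{1..j}. Y i \<omega>)" for j
    have S: "S j = P j - real j *\<^sub>R \<mu>" for j
      by (simp add: S_def P_def sum_subtractf scaleR_conv_of_real sum_constant_scaleR)
    have "{1..k} = {1..j} \<union> {j+1..k}" "{1..j} \<inter> {j+1..k} = {}" using j by auto
    then have "P k = P j + (\<Sum>i\<in>{j+1..k}. Y i \<omega>)"
      unfolding P_def by (simp add: sum.union_disjoint)
    then have y2: "(\<Sum>i\<in>{j+1..k}. Y i \<omega>) = P k - P j" by simp
    have "(real j * real (k - j)) *\<^sub>R (ybar Y 1 j \<omega> - ybar Y (j + 1) k \<omega>)
      = real (k - j) *\<^sub>R P j - real j *\<^sub>R (P k - P j)"
    proof -
      have "k - (j + 1) + 1 = k - j" "j - 1 + 1 = j" using j m by auto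
      then show ?thesis
        unfolding ybar_def y2 P_def[symmetric] using j m by (simp add: scaleR_diff_right)
    qed
    also have "\<dots> = real k *\<^sub>R S j - real j *\<^sub>R S k"
      using j by (simp add: S of_nat_diff algebra_simps)
    finally have "wnorm ?A (real k *\<^sub>R S j - real j *\<^sub>R S k)
      = real j * real (k - j) * wnorm ?A (ybar Y 1 j \<omega> - ybar Y (j + 1) k \<omega>)"
      by (simp add: wnorm_scaleR[symmetric])
    then show ?thesis by simp
  qed
  have ivl: "{m..k-1} = {m..<k}" "{m..<k} \<noteq> {}" using m by auto
  have "a * detector Y Sm m k \<omega> \<le> x \<longleftrightarrow> detector Y Sm m k \<omega> \<le> x / a"
    using a by (simp add: pos_le_divide_eq mult.commute)
  also have "\<dots> \<longleftrightarrow> (\<forall>j\<in>{m..<k}. wnorm ?A (real k *\<^sub>R S j - real j *\<^sub>R S k) / real m powr (3/2) \<le> x / a)"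
  proof -
    have "detector Y Sm m k \<omega> = Max ((\<lambda>j. wnorm ?A (real k *\<^sub>R S j - real j *\<^sub>R S k) / real m powr (3/2)) ` {m..<k})"
      unfolding detector_def ivl(1) by (intro arg_cong[where f = Max] image_cong refl summand)
    then show ?thesis using ivl(2) by simp
  qed
  also have "\<dots> \<longleftrightarrow> (\<forall>j\<in>{m..<k}. a / real m powr (3/2) * wnorm ?A (real k *\<^sub>R S j - real j *\<^sub>R S k) \<le> x)"
    using a by (simp add: pos_le_divide_eq mult.commute)
  finally show ?thesis .
qed

text \<open>The two levels come from solving \<open>(1 - e) * (h - d) \<le> x\<close> and
  \<open>(1 + e) * (h + d) \<le> x\<close> for \<open>h\<close>, with \<open>d < e\<close>. Because
  \<open>H\<close> is assumed to converge at every level, \<open>e\<close> need not avoid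
  discontinuities of \<open>F\<close>; continuity at \<open>x\<close> itself lets \<open>e\<close>
  tend to 0.\<close>

lemma conv_sandwich:
  fixes F :: "real \<Rightarrow> real"
  assumes M: "prob_space M" and F: "isCont F x"
    and H: "\<And>y. (\<lambda>m. measure M (H m y)) \<longlonglongrightarrow> F y"
    and sets: "\<And>y. eventually (\<lambda>m. T m \<in> sets M \<and> H m y \<in> sets M) sequentially"
    and approx: "\<And>e \<tau>. 0 < e \<Longrightarrow> e < 1 \<Longrightarrow> 0 < \<tau> \<Longrightarrow> eventually (\<lambda>m. \<exists>B\<in>sets M. measure M B \<le> \<tau> \<and>
      T m \<subseteq> H m (x / (1 - e) + e) \<union> B \<and> H m (x / (1 + e) - e) \<subseteq> T m \<union> B) sequentially"
  shows "(\<lambda>m. measure M (T m)) \<longlonglongrightarrow> F x"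
proof (rule tendstoI)
  interpret prob_space M by fact
  fix r :: real assume r: "0 < r"
  have lims: "((\<lambda>e. F (x / (1 - e) + e)) \<longlongrightarrow> F x) (at_right 0)" "((\<lambda>e. F (x / (1 + e) - e)) \<longlongrightarrow> F x) (at_right 0)"
    by (rule isCont_tendsto_compose[OF F], auto intro!: tendsto_eq_intros)+
  \<comment> \<open>The tolerance \<open>r\<close> is shared by the shift of the level in
    \<open>F\<close>, the convergence of \<open>H\<close> at the shifted levels, and the exceptional
    set.\<close>
  have "\<forall>\<^sub>F e in at_right 0. dist (F (x / (1 - e) + e)) (F x) < r / 3" "\<forall>\<^sub>F e in at_right 0. dist (F (x / (1 + e) - e)) (F x) < r / 3"
    using r by (simp_all only: tendstoD[OF lims(1)] tendstoD[OF lims(2)] divide_pos_pos zero_less_numeral)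
  moreover have "\<forall>\<^sub>F e::real in at_right 0. 0 < e" "\<forall>\<^sub>F e::real in at_right 0. e < 1"
    using eventually_at_right_real[of 0 1] by (auto elim: eventually_mono)
  ultimately have "\<forall>\<^sub>F e in at_right 0. 0 < e \<and> e < 1 \<and> dist (F (x / (1 - e) + e)) (F x) < r / 3 \<and> dist (F (x / (1 + e) - e)) (F x) < r / 3"
    by eventually_elim auto
  then obtain e where e: "0 < e" "e < 1" "dist (F (x / (1 - e) + e)) (F x) < r / 3" "dist (F (x / (1 + e) - e)) (F x) < r / 3"
    using eventually_happens'[OF trivial_limit_at_right_real] by blast
  have "\<forall>\<^sub>F m in sequentially. dist (measure M (H m (x / (1 - e) + e))) (F (x / (1 - e) + e)) < r / 3"
    "\<forall>\<^sub>F m in sequentially. dist (measure M (H m (x / (1 + e) - e))) (F (x / (1 + e) - e)) < r / 3"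
    using r by (simp_all only: tendstoD[OF H] divide_pos_pos zero_less_numeral)
  moreover have "\<forall>\<^sub>F m in sequentially. \<exists>B\<in>sets M. measure M B \<le> r / 3 \<and>
      T m \<subseteq> H m (x / (1 - e) + e) \<union> B \<and> H m (x / (1 + e) - e) \<subseteq> T m \<union> B"
    using e r by (intro approx) auto
  ultimately show "\<forall>\<^sub>F m in sequentially. dist (measure M (T m)) (F x) < r"
    using sets[of "x / (1 - e) + e"] sets[of "x / (1 + e) - e"]
  proof eventually_elim
    case (elim m)
    then obtain B where B: "B \<in> sets M" "measure M B \<le> r / 3"
      "T m \<subseteq> H m (x / (1 - e) + e) \<union> B" "H m (x / (1 + e) - e) \<subseteq> T m \<union> B"
      by blast
    have "measure M (T m) \<le> measure M (H m (x / (1 - e) + e)) + measure M B"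
      using elim B by (intro order_trans[OF finite_measure_mono measure_Un_le]) auto
    moreover have "measure M (H m (x / (1 + e) - e)) \<le> measure M (T m) + measure M B"
      using elim B by (intro order_trans[OF finite_measure_mono measure_Un_le]) auto
    ultimately show ?case
      using e B(2) elim(1,2) unfolding dist_real_def by linarith
  qed
qed

text \<open>The additive error \<open>d\<close> vanishes as \<open>m\<close> grows because \<open>\<xi> < 1/2\<close>.\<close>
lemma weighted_approx:
  fixes S B :: "nat \<Rightarrow> real^'p" and R A :: "real^'p^'p"
  assumes R: "invertible R"
    and err: "\<And>j. m \<le> j \<Longrightarrow> norm (S j - R *v B j) \<le> C * real j powr \<xi>"
    and A: "\<And>z. wnorm A (R *v z) \<in> {(1 - e) * wnorm (mat 1) z..(1 + e) * wnorm (mat 1) z}"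
    and K: "\<And>x. norm (matrix_inv R *v x) \<le> K * norm x" "0 \<le> K" and C: "0 \<le> C"
    and e: "0 < e" "e < 1" and xi: "0 < \<xi>" "\<xi> < 1/2" and eta: "0 < \<eta>"
    and m: "0 < m" and jk: "m \<le> j" "j < k"
  defines "c \<equiv> (real m / real k) powr (3/2 + \<eta>) / real m powr (3/2)"
    and "d \<equiv> 2 * K * C / sqrt CARD('p) * real m powr (\<xi> - 1/2)"
  shows "c * wnorm A (real k *\<^sub>R S j - real j *\<^sub>R S k) \<in>
    {(1 - e) * (c * wnorm (mat 1) (real k *\<^sub>R B j - real j *\<^sub>R B k) - d)..
     (1 + e) * (c * wnorm (mat 1) (real k *\<^sub>R B j - real j *\<^sub>R B k) + d)}"
proof -
  \<comment> \<open>The coupling error is pulled back through \<open>R\<close>, so that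
    \<open>S j = R *v (B j + E j)\<close> holds exactly and \<open>A\<close> can be applied to a
    vector of the form \<open>R *v z\<close>.\<close>
  define E where "E j = matrix_inv R *v (S j - R *v B j)" for j
  have S: "S j = R *v (B j + E j)" for j
    by (simp add: E_def matrix_vector_right_distrib matrix_vector_mul_assoc matrix_inv_mult[OF R])
  have E: "norm (E i) \<le> K * (C * real k powr \<xi>)" if "m \<le> i" "i \<le> k" for i
  proof -
    have "norm (E i) \<le> K * norm (S i - R *v B i)" unfolding E_def by (rule K)
    also have "\<dots> \<le> K * (C * real i powr \<xi>)" using err[OF that(1)] K(2) by (rule mult_left_mono)
    also have "\<dots> \<le> K * (C * real k powr \<xi>)"
      using that xi K C by (intro mult_left_mono powr_mono2) auto
    finally show ?thesis .
  qed
  define z where "z = real k *\<^sub>R (B j + E j) - real j *\<^sub>R (B k + E k)"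
  define b where "b = real k *\<^sub>R B j - real j *\<^sub>R B k"
  have Sz: "real k *\<^sub>R S j - real j *\<^sub>R S k = R *v z"
    by (simp add: S z_def matrix_vector_mult_diff_distrib matrix_vector_mult_scaleR)
  have "norm (z - b) = norm (real k *\<^sub>R E j - real j *\<^sub>R E k)"
    by (simp add: z_def b_def algebra_simps)
  also have "\<dots> \<le> real k * norm (E j) + real j * norm (E k)"
    using norm_triangle_ineq4[of "real k *\<^sub>R E j" "real j *\<^sub>R E k"] by simp
  also have "\<dots> \<le> real k * (K * (C * real k powr \<xi>)) + real k * (K * (C * real k powr \<xi>))"
    using jk K C by (intro add_mono mult_mono E) auto
  also have "\<dots> = 2 * K * C * real k powr (1 + \<xi>)"
    using jk by (simp add: powr_add)
  finally have zb: "norm (z - b) \<le> 2 * K * C * real k powr (1 + \<xi>)" .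
  have c0: "0 \<le> c" by (simp add: c_def)
  \<comment> \<open>Uniformity in \<open>k\<close>: since \<open>m / k\<close> is at most 1, its
    exponent may be lowered from \<open>3/2 + \<eta>\<close> to \<open>1 + \<xi>\<close>, after
    which the powers of \<open>k\<close> cancel.\<close>
  have ck: "c * real k powr (1 + \<xi>) \<le> real m powr (\<xi> - 1/2)"
  proof -
    have "(real m / real k) powr (3/2 + \<eta>) \<le> (real m / real k) powr (1 + \<xi>)"
      using m jk xi eta by (intro powr_mono') auto
    then have "c * real k powr (1 + \<xi>) \<le> (real m / real k) powr (1 + \<xi>) / real m powr (3/2) * real k powr (1 + \<xi>)"
      unfolding c_def by (intro mult_right_mono divide_right_mono) auto
    also have "\<dots> = real m powr (1 + \<xi>) / real m powr (3/2)"
      using m jk by (simp add: powr_divide)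
    also have "\<dots> = real m powr (\<xi> - 1/2)" by (simp add: powr_diff[symmetric])
    finally show ?thesis .
  qed
  have "\<bar>c * wnorm (mat 1) z - c * wnorm (mat 1) b\<bar> = c * \<bar>wnorm (mat 1) z - wnorm (mat 1) b\<bar>"
    using c0 by (simp add: abs_mult flip: right_diff_distrib)
  also have "\<dots> \<le> c * (2 * K * C * real k powr (1 + \<xi>) / sqrt CARD('p))"
    using zb c0 by (intro mult_left_mono order_trans[OF wnorm_mat_1_diff] divide_right_mono) auto
  also have "\<dots> = 2 * K * C / sqrt CARD('p) * (c * real k powr (1 + \<xi>))" by simp
  also have "\<dots> \<le> d" unfolding d_def using ck K C by (intro mult_left_mono) auto
  finally have zb': "\<bar>c * wnorm (mat 1) z - c * wnorm (mat 1) b\<bar> \<le> d" .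
  have "(1 - e) * (c * wnorm (mat 1) b - d) \<le> (1 - e) * (c * wnorm (mat 1) z)"
    using zb' e by (intro mult_left_mono) auto
  also have "\<dots> \<le> c * wnorm A (R *v z)"
    using A[of z] c0 mult_left_mono[of "(1 - e) * wnorm (mat 1) z" _ c] by (simp add: mult.left_commute)
  finally have lo: "(1 - e) * (c * wnorm (mat 1) b - d) \<le> c * wnorm A (R *v z)" .
  have "c * wnorm A (R *v z) \<le> (1 + e) * (c * wnorm (mat 1) z)"
    using A[of z] c0 mult_left_mono[of _ "(1 + e) * wnorm (mat 1) z" c] by (simp add: mult.left_commute)
  also have "\<dots> \<le> (1 + e) * (c * wnorm (mat 1) b + d)"
    using zb' e by (intro mult_left_mono) auto
  finally show ?thesis using lo unfolding Sz b_def by simp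
qed

text \<open>Law equality moves the event to the space of \<open>W\<close>, where the grid of mesh
  \<open>1/m\<close> becomes dense. Only the distribution of the glued paths for each separate
  \<open>m\<close> matters, so no joint law of the motions over different \<open>m\<close> is
  required.\<close>

lemma glued_measure_tendsto:
  fixes W1 W2 :: "nat \<Rightarrow> real \<Rightarrow> 'a \<Rightarrow> real^'p" and W :: "real \<Rightarrow> 'b \<Rightarrow> real^'p"
  assumes M: "prob_space M" and W1: "\<And>m. std_BM M (W1 m)" and W2: "\<And>m. std_BM M (W2 m)"
    and ind: "\<And>m. prob_space.indep_var M
           (PiM {0..} (\<lambda>_. borel)) (\<lambda>\<omega>. \<lambda>t\<in>{0..}. W1 m t \<omega>)
           (PiM {0..} (\<lambda>_. borel)) (\<lambda>\<omega>. \<lambda>t\<in>{0..}. W2 m t \<omega>)"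
    and N: "prob_space N" and W: "std_BM N W"
  defines "B \<equiv> \<lambda>m j \<omega>. W2 m (real m) \<omega> + W1 m (real (j - m)) \<omega>"
  shows "(\<lambda>m. measure M {\<omega>\<in>space M. \<forall>k>m. \<forall>j\<in>{m..<k}. (real m / real k) powr (3/2 + \<eta>) / real m powr (3/2) *
      wnorm (mat 1) (real k *\<^sub>R B m j \<omega> - real j *\<^sub>R B m k \<omega>) \<le> y})
    \<longlonglongrightarrow> measure N {\<omega>\<in>space N. (SUP st\<in>{(s, t). 1 \<le> s \<and> s \<le> t}.
      ereal (snd st powr (- 3/2 - \<eta>) * wnorm (mat 1) (snd st *\<^sub>R W (fst st) \<omega> - fst st *\<^sub>R W (snd st) \<omega>))) \<le> ereal y}"
proof -
  define h where "h s t \<omega> = t powr (- 3/2 - \<eta>) * wnorm (mat 1) (t *\<^sub>R W s \<omega> - s *\<^sub>R W t \<omega>)" for s t \<omega>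
  have "(\<lambda>m. measure N {\<omega>\<in>space N. \<forall>k>m. \<forall>j\<in>{m..<k}. h (real j / real m) (real k / real m) \<omega> \<le> y})
    \<longlonglongrightarrow> measure N {\<omega>\<in>space N. \<forall>s t. 1 \<le> s \<longrightarrow> s \<le> t \<longrightarrow> h s t \<omega> \<le> y}"
  proof (rule measure_grid_sup[OF N])
    show "h s t \<in> borel_measurable N" if "1 \<le> s" "s \<le> t" for s t
    proof -
      have "W s \<in> borel_measurable N" "W t \<in> borel_measurable N"
        using that by (auto intro: std_BM_measurable[OF W])
      then show ?thesis unfolding h_def by measurable
    qed
    show "continuous_on {(s, t). 1 \<le> s \<and> s \<le> t} (\<lambda>(s, t). h s t \<omega>)" if "\<omega> \<in> space N" for \<omega>
      unfolding h_def wnorm_mat_1 case_prod_beta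
      by (intro continuous_intros continuous_on_compose2[OF std_BM_continuous[OF W that]]) auto
  qed (simp_all add: h_def wnorm_mat_1)
  moreover have "\<forall>\<^sub>F m in sequentially. measure M {\<omega>\<in>space M. \<forall>k>m. \<forall>j\<in>{m..<k}. (real m / real k) powr (3/2 + \<eta>) / real m powr (3/2) *
      wnorm (mat 1) (real k *\<^sub>R B m j \<omega> - real j *\<^sub>R B m k \<omega>) \<le> y}
    = measure N {\<omega>\<in>space N. \<forall>k>m. \<forall>j\<in>{m..<k}. h (real j / real m) (real k / real m) \<omega> \<le> y}"
    using eventually_gt_at_top[of 0]
  proof eventually_elim
    case (elim m)
    define g where "g j k v = (real m / real k) powr (3/2 + \<eta>) / real m powr (3/2) *
      wnorm (mat 1) (real k *\<^sub>R fst v - real j *\<^sub>R snd v)" for j k and v :: "(real^'p) \<times> (real^'p)"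
    have g: "g j k \<in> borel_measurable (borel \<Otimes>\<^sub>M borel)" for j k
      unfolding g_def by measurable
    have "g j k (sqrt m *\<^sub>R W (real j / real m) \<omega>, sqrt m *\<^sub>R W (real k / real m) \<omega>) = h (real j / real m) (real k / real m) \<omega>"
      if "m < k" for j k \<omega>
    proof -
      \<comment> \<open>The normalisation splits into \<open>sqrt m\<close> from Brownian scaling
        and \<open>m\<close> from passing from \<open>j\<close> and \<open>k\<close> to the times
        \<open>j / m\<close> and \<open>k / m\<close>.\<close>
      have m32: "real m powr (3/2) = sqrt m * real m"
        using elim powr_add[of "real m" "1/2" 1] by (simp add: powr_half_sqrt)
      have "real k *\<^sub>R (sqrt m *\<^sub>R W (real j / real m) \<omega>) - real j *\<^sub>R (sqrt m *\<^sub>R W (real k / real m) \<omega>)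
        = (sqrt m * real m) *\<^sub>R ((real k / real m) *\<^sub>R W (real j / real m) \<omega> - (real j / real m) *\<^sub>R W (real k / real m) \<omega>)"
        using elim by (simp add: scaleR_diff_right mult.commute)
      moreover have "(real m / real k) powr (3/2 + \<eta>) = (real k / real m) powr (- 3/2 - \<eta>)"
        using elim that by (simp add: powr_divide powr_minus_divide powr_diff powr_add)
      ultimately show ?thesis
        using elim by (simp add: g_def h_def wnorm_scaleR m32)
    qed
    moreover have "measure M {\<omega>\<in>space M. \<forall>k>m. \<forall>j\<in>{m..<k}. g j k (B m j \<omega>, B m k \<omega>) \<le> y}
      = measure N {\<omega>\<in>space N. \<forall>k>m. \<forall>j\<in>{m..<k}. g j k (sqrt m *\<^sub>R W (real j / real m) \<omega>, sqrt m *\<^sub>R W (real k / real m) \<omega>) \<le> y}"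
      unfolding B_def by (rule measure_glued_eq_scaled[OF M W1 W2 elim ind N W g])
    ultimately show ?case by (simp add: g_def cong: conj_cong)
  qed
  moreover have "{\<omega>\<in>space N. (SUP st\<in>{(s, t). 1 \<le> s \<and> s \<le> t}.
      ereal (snd st powr (- 3/2 - \<eta>) * wnorm (mat 1) (snd st *\<^sub>R W (fst st) \<omega> - fst st *\<^sub>R W (snd st) \<omega>))) \<le> ereal y}
    = {\<omega>\<in>space N. \<forall>s t. 1 \<le> s \<longrightarrow> s \<le> t \<longrightarrow> h s t \<omega> \<le> y}"
    by (auto simp: SUP_le_iff h_def)
  ultimately show ?thesis
    by (simp only: tendsto_cong)
qed

theorem theorem2p1:
  fixes M :: "'a measure"
    and X :: "nat \<Rightarrow> 'a \<Rightarrow> real^'d"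
    and pts :: "'p::finite \<Rightarrow> real^'d"
    and \<Sigma> :: "real^'p^'p"
    and W1 W2 :: "nat \<Rightarrow> real \<Rightarrow> 'a \<Rightarrow> real^'p"
    and \<Sigma>m :: "nat \<Rightarrow> 'a \<Rightarrow> real^'p^'p"
    and \<xi> \<eta> :: real
  defines "Y \<equiv> indic_vec X pts"
  assumes "prob_space M"
    and "\<And>i. X i \<in> borel_measurable M"
    and "stationary M Y"
    and "(\<lambda>n. cov_mat M (Y 1) (Y (n + 2)) + cov_mat M (Y (n + 2)) (Y 1))
           sums (\<Sigma> - cov_mat M (Y 1) (Y 1))"
    and "pos_def \<Sigma>"
    and "\<And>m. std_BM M (W1 m)" and "\<And>m. std_BM M (W2 m)"
    and "\<And>m. prob_space.indep_var M
           (PiM {0..} (\<lambda>_. borel)) (\<lambda>\<omega>. \<lambda>t\<in>{0..}. W1 m t \<omega>)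
           (PiM {0..} (\<lambda>_. borel)) (\<lambda>\<omega>. \<lambda>t\<in>{0..}. W2 m t \<omega>)"
    and "0 < \<xi>" and "\<xi> < 1/2"
    and "bounded_in_prob M (\<lambda>m \<omega>. SUP k\<in>{m<..}. ereal (
           norm ((\<Sum>i\<in>{m+1..k}. Y i \<omega> - integral\<^sup>L M (Y 1)) - mat_sqrt \<Sigma> *v W1 m (real (k - m)) \<omega>)
           / real (k - m) powr \<xi>))"
    and "bounded_in_prob M (\<lambda>m \<omega>. ereal (
           norm ((\<Sum>i\<in>{1..m}. Y i \<omega> - integral\<^sup>L M (Y 1)) - mat_sqrt \<Sigma> *v W2 m (real m) \<omega>)
           / real m powr \<xi>))"
    and "\<And>m. \<exists>g \<in> borel_measurable (PiM {1..m} (\<lambda>_. borel)).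
           \<forall>\<omega>\<in>space M. \<Sigma>m m \<omega> = g (\<lambda>i\<in>{1..m}. Y i \<omega>)"
    and "\<And>m \<omega>. \<omega> \<in> space M \<Longrightarrow> invertible (\<Sigma>m m \<omega>)"
    and "conv_in_prob M \<Sigma>m \<Sigma>"
    and "\<eta> > 0"
  shows "\<forall>(N :: 'b measure) (W :: real \<Rightarrow> 'b \<Rightarrow> real^'p). prob_space N \<and> std_BM N W \<longrightarrow>
           conv_distr M
             (\<lambda>m \<omega>. SUP k\<in>{m<..}. ereal ((real m / real k) powr (3/2 + \<eta>) * detector Y \<Sigma>m m k \<omega>))
             N
             (\<lambda>\<omega>. SUP st\<in>{(s, t). 1 \<le> s \<and> s \<le> t}.
                 ereal (snd st powr (- 3/2 - \<eta>) *
                        wnorm (mat 1) (snd st *\<^sub>R W (fst st) \<omega> - fst st *\<^sub>R W (snd st) \<omega>)))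
         \<and> (AE \<omega> in N. (SUP st\<in>{(s, t). 1 \<le> s \<and> s \<le> t}.
                 ereal (snd st powr (- 3/2 - \<eta>) *
                        wnorm (mat 1) (snd st *\<^sub>R W (fst st) \<omega> - fst st *\<^sub>R W (snd st) \<omega>))) < \<infinity>)"
proof (intro allI impI)
  fix N :: "'b measure" and W :: "real \<Rightarrow> 'b \<Rightarrow> real^'p"
  assume "prob_space N \<and> std_BM N W"
  then have N: "prob_space N" and W: "std_BM N W" by auto
  note M = assms(2) and pd = assms(6) and W1 = assms(7) and W2 = assms(8) and ind = assms(9)
    and xi = assms(10,11) and O1 = assms(12) and O2 = assms(13) and est = assms(14) and inv = assms(15)
    and lim = assms(16) and eta = assms(17)
  interpret prob_space M by (rule M)
  define R where "R = mat_sqrt \<Sigma>"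
  have R: "pos_def R" "R ** R = \<Sigma>" using mat_sqrt[OF pd] by (simp_all add: R_def)
  have invR: "invertible R" using R(1) by (rule pos_def_invertible)
  define \<mu> where "\<mu> = integral\<^sup>L M (Y 1)"
  define S where "S j \<omega> = (\<Sum>i\<in>{1..j}. Y i \<omega> - \<mu>)" for j \<omega>
  define B where "B m j \<omega> = W2 m (real m) \<omega> + W1 m (real (j - m)) \<omega>" for m j \<omega>
  define c where "c m k = (real m / real k) powr (3/2 + \<eta>) / real m powr (3/2)" for m k :: nat
  have [measurable]: "W1 m u \<in> borel_measurable M" "W2 m u \<in> borel_measurable M" if "0 \<le> u" for m u
    using std_BM_measurable[OF W1 that] std_BM_measurable[OF W2 that] by auto
  have [measurable]: "Y i \<in> borel_measurable M" for i
    unfolding Y_def using assms(3) by (rule borel_measurable_indic_vec)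
  have Sm[measurable]: "\<Sigma>m m \<in> borel_measurable M" for m
  \<comment> \<open>Measurability of the estimator comes from its being a measurable function of the
    first \<open>m\<close> observations.\<close>
  proof -
    obtain g where g: "g \<in> borel_measurable (PiM {1..m} (\<lambda>_. borel))"
      "\<forall>\<omega>\<in>space M. \<Sigma>m m \<omega> = g (\<lambda>i\<in>{1..m}. Y i \<omega>)" using est by blast
    have "(\<lambda>\<omega>. \<lambda>i\<in>{1..m}. Y i \<omega>) \<in> measurable M (PiM {1..m} (\<lambda>_. borel))"
      by (rule measurable_restrict) measurable
    from measurable_compose[OF this g(1)] show ?thesis
      by (rule measurable_cong[THEN iffD1, rotated]) (simp add: g(2))
  qed
  have [measurable]: "(\<lambda>\<omega>. matrix_inv (\<Sigma>m m \<omega>)) \<in> borel_measurable M" for m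
    by (rule borel_measurable_matrix_inv[OF Sm inv])
  have [measurable]: "S j \<in> borel_measurable M" for j unfolding S_def by measurable
  have [measurable]: "B m j \<in> borel_measurable M" for m j unfolding B_def by measurable
  have Rv[measurable]: "(\<lambda>\<omega>. R *v f \<omega>) \<in> borel_measurable M" if "f \<in> borel_measurable M" for f
    by (rule borel_measurable_continuous_on[OF _ that]) (intro linear_continuous_on matrix_vector_mul_bounded_linear)

  \<comment> \<open>For \<open>m > 0\<close>, \<open>T m x\<close> is the event that the statistic
    is at most \<open>x\<close>; \<open>H m y\<close> is its Gaussian counterpart. Quantifiers in
    place of suprema make both visibly countable intersections.\<close>
  define T where "T m x = {\<omega>\<in>space M. \<forall>k. m < k \<longrightarrow> (\<forall>j\<in>{m..<k}.
    c m k * wnorm (matrix_inv (\<Sigma>m m \<omega>)) (real k *\<^sub>R S j \<omega> - real j *\<^sub>R S k \<omega>) \<le> x)}" for m x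
  define H where "H m y = {\<omega>\<in>space M. \<forall>k. m < k \<longrightarrow> (\<forall>j\<in>{m..<k}.
    c m k * wnorm (mat 1) (real k *\<^sub>R B m j \<omega> - real j *\<^sub>R B m k \<omega>) \<le> y)}" for m y
  define L where "L \<omega> = (SUP st\<in>{(s, t). 1 \<le> s \<and> s \<le> t}.
                 ereal (snd st powr (- 3/2 - \<eta>) *
                        wnorm (mat 1) (snd st *\<^sub>R W (fst st) \<omega> - fst st *\<^sub>R W (snd st) \<omega>)))" for \<omega>
  define F where "F x = measure N {\<omega>\<in>space N. L \<omega> \<le> ereal x}" for x
  have [measurable]: "T m x \<in> sets M" "H m x \<in> sets M" for m x
    unfolding T_def H_def by measurable
  have HF: "(\<lambda>m. measure M (H m y)) \<longlonglongrightarrow> F y" for y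
    using glued_measure_tendsto[where ?W1.0 = W1 and ?W2.0 = W2 and \<eta> = \<eta> and y = y, OF M W1 W2 ind N W]
    unfolding H_def F_def L_def B_def c_def .

  \<comment> \<open>Comparison with the Gaussian statistic outside a small event\<close>
  have approx: "\<forall>\<^sub>F m in sequentially. \<exists>D\<in>sets M. measure M D \<le> \<tau> \<and>
      T m x \<subseteq> H m (x / (1 - e) + e) \<union> D \<and> H m (x / (1 + e) - e) \<subseteq> T m x \<union> D"
    if e: "0 < e" "e < 1" and \<tau>: "0 < \<tau>" for e \<tau> x
  proof -
    define Z1 where "Z1 m \<omega> = (SUP k\<in>{m<..}. ereal (norm ((\<Sum>i\<in>{m+1..k}. Y i \<omega> - \<mu>) - R *v W1 m (real (k - m)) \<omega>)
           / real (k - m) powr \<xi>))" for m \<omega>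
    define Z2 where "Z2 m \<omega> = ereal (norm (S m \<omega> - R *v W2 m (real m) \<omega>) / real m powr \<xi>)" for m \<omega>
    have [measurable]: "Z1 m \<in> borel_measurable M" "Z2 m \<in> borel_measurable M" for m
      unfolding Z1_def Z2_def by measurable
    obtain d where d: "0 < d" "\<And>A z. dist A \<Sigma> < d \<Longrightarrow> invertible A \<Longrightarrow>
      wnorm (matrix_inv A) (R *v z) \<in> {(1 - e) * wnorm (mat 1) z..(1 + e) * wnorm (mat 1) z}"
      using wnorm_matrix_inv_near[OF R e] by metis
    have bound: "\<exists>C N. \<forall>m\<ge>N. measure M {\<omega>\<in>space M. \<bar>Z m \<omega>\<bar> > ereal C} \<le> \<tau> / 3"
      if "bounded_in_prob M Z" for Z
      using that divide_pos_pos[OF \<tau> zero_less_numeral] unfolding bounded_in_prob_def by blast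
    have "bounded_in_prob M Z1" "bounded_in_prob M Z2"
      using O1 O2 by (simp_all add: Z1_def[abs_def] Z2_def[abs_def] S_def R_def \<mu>_def)
    from this[THEN bound] obtain C1 N1 C2 N2
      where Z1: "\<And>m. N1 \<le> m \<Longrightarrow> measure M {\<omega>\<in>space M. \<bar>Z1 m \<omega>\<bar> > ereal C1} \<le> \<tau> / 3"
        and Z2: "\<And>m. N2 \<le> m \<Longrightarrow> measure M {\<omega>\<in>space M. \<bar>Z2 m \<omega>\<bar> > ereal C2} \<le> \<tau> / 3"
      by blast
    have ereal_le_abs: "z \<le> \<bar>z\<bar>" for z :: ereal by (cases z) auto
    define K where "K = (\<Sum>i\<in>UNIV. \<Sum>j\<in>UNIV. \<bar>matrix_inv R $ i $ j\<bar>)"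
    have K: "norm (matrix_inv R *v z) \<le> K * norm z" "0 \<le> K" for z
      unfolding K_def by (rule norm_matrix_vector_le) (intro sum_nonneg abs_ge_zero)
    \<comment> \<open>The error at index \<open>i\<close> is the error of the second coupling at
      \<open>m\<close> plus that of the first coupling after \<open>m\<close>; the constants add.
      Absolute values guarantee signs, since \<open>O1\<close> and \<open>O2\<close> give arbitrary
      reals.\<close>
    define C where "C = \<bar>C1\<bar> + \<bar>C2\<bar>"
    define \<delta> where "\<delta> m = 2 * K * C / sqrt CARD('p) * real m powr (\<xi> - 1/2)" for m
    have "(\<lambda>m. real m powr (\<xi> - 1/2)) \<longlonglongrightarrow> 0"
      by (rule tendsto_neg_powr[OF _ filterlim_real_sequentially]) (use xi in simp)
    then have "\<delta> \<longlonglongrightarrow> 0" unfolding \<delta>_def by (rule tendsto_mult_right_zero)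
    then have ev_d: "\<forall>\<^sub>F m in sequentially. \<delta> m < e" using e(1) by (rule order_tendstoD)
    \<comment> \<open>Half of \<open>d\<close>, because the complement of this event gives only a
      non-strict bound while the neighbourhood of radius \<open>d\<close> is open.\<close>
    have "(\<lambda>m. measure M {\<omega>\<in>space M. dist (\<Sigma>m m \<omega>) \<Sigma> > d / 2}) \<longlonglongrightarrow> 0"
      using lim half_gt_zero[OF d(1)] unfolding conv_in_prob_def by blast
    then have ev_S: "\<forall>\<^sub>F m in sequentially. measure M {\<omega>\<in>space M. dist (\<Sigma>m m \<omega>) \<Sigma> > d / 2} < \<tau> / 3"
      using \<tau> by (intro order_tendstoD(2)) auto
    show ?thesis
      using ev_d ev_S eventually_gt_at_top[of 0] eventually_ge_at_top[of N1] eventually_ge_at_top[of N2]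
    proof eventually_elim
      case (elim m)
      \<comment> \<open>Three ways to fail, each of probability at most \<open>\<tau> / 3\<close>:
        the coupling after \<open>m\<close>, the coupling up to \<open>m\<close>, and the
        estimator.\<close>
      define D1 where "D1 = {\<omega>\<in>space M. \<bar>Z1 m \<omega>\<bar> > ereal C1}"
      define D2 where "D2 = {\<omega>\<in>space M. \<bar>Z2 m \<omega>\<bar> > ereal C2}"
      define D3 where "D3 = {\<omega>\<in>space M. dist (\<Sigma>m m \<omega>) \<Sigma> > d / 2}"
      have [measurable]: "D1 \<in> sets M" "D2 \<in> sets M" "D3 \<in> sets M"
        unfolding D1_def D2_def D3_def by measurable
      have "measure M (D1 \<union> D2 \<union> D3) \<le> measure M D1 + measure M D2 + measure M D3"
        by (intro order_trans[OF measure_Un_le] add_mono order_refl) auto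
      also have "\<dots> \<le> \<tau>"
        using Z1[OF elim(4)] Z2[OF elim(5)] elim(2) by (simp add: D1_def D2_def D3_def)
      finally have prob: "measure M (D1 \<union> D2 \<union> D3) \<le> \<tau>" .
      have key: "c m k * wnorm (matrix_inv (\<Sigma>m m \<omega>)) (real k *\<^sub>R S j \<omega> - real j *\<^sub>R S k \<omega>) \<in>
          {(1 - e) * (c m k * wnorm (mat 1) (real k *\<^sub>R B m j \<omega> - real j *\<^sub>R B m k \<omega>) - \<delta> m)..
           (1 + e) * (c m k * wnorm (mat 1) (real k *\<^sub>R B m j \<omega> - real j *\<^sub>R B m k \<omega>) + \<delta> m)}"
        if om: "\<omega> \<in> space M" "\<omega> \<notin> D1 \<union> D2 \<union> D3" and jk: "m \<le> j" "j < k" for \<omega> j k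
        unfolding c_def \<delta>_def
      proof (rule weighted_approx[OF invR _ _ K _ e xi eta elim(3) jk])
        show "0 \<le> C" by (simp add: C_def)
        show "wnorm (matrix_inv (\<Sigma>m m \<omega>)) (R *v z) \<in> {(1 - e) * wnorm (mat 1) z..(1 + e) * wnorm (mat 1) z}" for z
          using om d(1) by (intro d(2) inv) (auto simp: D3_def)
        show "norm (S i \<omega> - R *v B m i \<omega>) \<le> C * real i powr \<xi>" if i: "m \<le> i" for i
        proof -
          have m_le: "real m powr \<xi> \<le> real i powr \<xi>"
            using i xi by (intro powr_mono2) auto
          have "Z2 m \<omega> \<le> ereal C2"
            using om by (auto simp: D2_def not_less intro: order_trans[OF ereal_le_abs])
          then have "norm (S m \<omega> - R *v W2 m (real m) \<omega>) \<le> C2 * real m powr \<xi>"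
            using elim(3) by (simp add: Z2_def pos_divide_le_eq)
          also have "\<dots> \<le> \<bar>C2\<bar> * real i powr \<xi>"
            using m_le by (intro mult_mono) auto
          finally have first: "norm (S m \<omega> - R *v W2 m (real m) \<omega>) \<le> \<bar>C2\<bar> * real i powr \<xi>" .
          have second: "norm ((\<Sum>l\<in>{m+1..i}. Y l \<omega> - \<mu>) - R *v W1 m (real (i - m)) \<omega>) \<le> \<bar>C1\<bar> * real i powr \<xi>"
          \<comment> \<open>The supremum in \<open>Z1\<close> runs over indices beyond
            \<open>m\<close> only; at \<open>i = m\<close> the sum is empty and the Brownian motion
            starts at 0.\<close>
          proof (cases "i = m")
            case True
            then show ?thesis using std_BM_zero[OF W1 om(1)] by simp
          next
            case False
            then have "m < i" using i by simp
            have "Z1 m \<omega> \<le> ereal C1"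
              using om by (auto simp: D1_def not_less intro: order_trans[OF ereal_le_abs])
            then have "norm ((\<Sum>l\<in>{m+1..i}. Y l \<omega> - \<mu>) - R *v W1 m (real (i - m)) \<omega>) / real (i - m) powr \<xi> \<le> C1"
              using \<open>m < i\<close> unfolding Z1_def SUP_le_iff by simp
            then have "norm ((\<Sum>l\<in>{m+1..i}. Y l \<omega> - \<mu>) - R *v W1 m (real (i - m)) \<omega>) \<le> C1 * real (i - m) powr \<xi>"
              using \<open>m < i\<close> by (simp add: pos_divide_le_eq)
            also have "\<dots> \<le> \<bar>C1\<bar> * real i powr \<xi>"
              using xi by (intro mult_mono powr_mono2) auto
            finally show ?thesis .
          qed
          have "{1..i} = {1..m} \<union> {m+1..i}" "{1..m} \<inter> {m+1..i} = {}" using i by auto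
          then have "S i \<omega> = S m \<omega> + (\<Sum>l\<in>{m+1..i}. Y l \<omega> - \<mu>)"
            unfolding S_def by (simp add: sum.union_disjoint)
          then have "S i \<omega> - R *v B m i \<omega> = (S m \<omega> - R *v W2 m (real m) \<omega>) +
              ((\<Sum>l\<in>{m+1..i}. Y l \<omega> - \<mu>) - R *v W1 m (real (i - m)) \<omega>)"
            by (simp add: B_def matrix_vector_right_distrib)
          also have "norm \<dots> \<le> \<bar>C2\<bar> * real i powr \<xi> + \<bar>C1\<bar> * real i powr \<xi>"
            by (intro norm_triangle_mono first second)
          finally show ?thesis by (simp add: C_def algebra_simps)
        qed
      qed
      have "T m x \<subseteq> H m (x / (1 - e) + e) \<union> (D1 \<union> D2 \<union> D3)"
      proof
        fix \<omega> assume T: "\<omega> \<in> T m x"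
        show "\<omega> \<in> H m (x / (1 - e) + e) \<union> (D1 \<union> D2 \<union> D3)"
        proof (cases "\<omega> \<in> D1 \<union> D2 \<union> D3")
          case False
          have om: "\<omega> \<in> space M" using T by (simp add: T_def)
          have "c m k * wnorm (mat 1) (real k *\<^sub>R B m j \<omega> - real j *\<^sub>R B m k \<omega>) \<le> x / (1 - e) + e"
            if jk: "m \<le> j" "j < k" for j k
          proof -
            let ?h = "c m k * wnorm (mat 1) (real k *\<^sub>R B m j \<omega> - real j *\<^sub>R B m k \<omega>)"
            have "c m k * wnorm (matrix_inv (\<Sigma>m m \<omega>)) (real k *\<^sub>R S j \<omega> - real j *\<^sub>R S k \<omega>) \<le> x"
              using T jk by (simp add: T_def)
            with key[OF om False jk] have "(1 - e) * (?h - \<delta> m) \<le> x" by simp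
            then have "?h - \<delta> m \<le> x / (1 - e)" using e by (simp add: pos_le_divide_eq mult.commute)
            with elim(1) show ?thesis by linarith
          qed
          with om show ?thesis by (simp add: H_def)
        qed simp
      qed
      moreover have "H m (x / (1 + e) - e) \<subseteq> T m x \<union> (D1 \<union> D2 \<union> D3)"
      proof
        fix \<omega> assume H: "\<omega> \<in> H m (x / (1 + e) - e)"
        show "\<omega> \<in> T m x \<union> (D1 \<union> D2 \<union> D3)"
        proof (cases "\<omega> \<in> D1 \<union> D2 \<union> D3")
          case False
          have om: "\<omega> \<in> space M" using H by (simp add: H_def)
          have "c m k * wnorm (matrix_inv (\<Sigma>m m \<omega>)) (real k *\<^sub>R S j \<omega> - real j *\<^sub>R S k \<omega>) \<le> x"
            if jk: "m \<le> j" "j < k" for j k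
          proof -
            let ?h = "c m k * wnorm (mat 1) (real k *\<^sub>R B m j \<omega> - real j *\<^sub>R B m k \<omega>)"
            have "?h \<le> x / (1 + e) - e" using H jk by (simp add: H_def)
            with elim(1) have "?h + \<delta> m \<le> x / (1 + e)" by linarith
            then have "(1 + e) * (?h + \<delta> m) \<le> x" using e by (simp add: pos_le_divide_eq mult.commute)
            with key[OF om False jk] show ?thesis by simp
          qed
          with om show ?thesis by (simp add: T_def)
        qed simp
      qed
      ultimately show ?case using prob by (intro bexI[of _ "D1 \<union> D2 \<union> D3"]) auto
    qed
  qed

  \<comment> \<open>From events to the distribution function of the statistic\<close>
  have T_eq: "{\<omega>\<in>space M. (SUP k\<in>{m<..}. ereal ((real m / real k) powr (3/2 + \<eta>) * detector Y \<Sigma>m m k \<omega>)) \<le> ereal x} = T m x"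
    if m: "0 < m" for m x
  proof -
    have "(real m / real k) powr (3/2 + \<eta>) * detector Y \<Sigma>m m k \<omega> \<le> x \<longleftrightarrow>
      (\<forall>j\<in>{m..<k}. c m k * wnorm (matrix_inv (\<Sigma>m m \<omega>)) (real k *\<^sub>R S j \<omega> - real j *\<^sub>R S k \<omega>) \<le> x)"
      if "m < k" for k \<omega>
      unfolding c_def S_def using m that by (intro detector_le_iff) auto
    then show ?thesis unfolding T_def SUP_le_iff by auto
  qed
  have "(\<lambda>m. measure M {\<omega>\<in>space M. (SUP k\<in>{m<..}. ereal ((real m / real k) powr (3/2 + \<eta>) * detector Y \<Sigma>m m k \<omega>)) \<le> ereal x})
    \<longlonglongrightarrow> F x" if "isCont F x" for x
  proof (rule Lim_transform_eventually)
    show "(\<lambda>m. measure M (T m x)) \<longlonglongrightarrow> F x"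
      by (rule conv_sandwich[OF M that HF _ approx]) auto
    show "\<forall>\<^sub>F m in sequentially. measure M (T m x) =
      measure M {\<omega>\<in>space M. (SUP k\<in>{m<..}. ereal ((real m / real k) powr (3/2 + \<eta>) * detector Y \<Sigma>m m k \<omega>)) \<le> ereal x}"
      using eventually_gt_at_top[of 0] by eventually_elim (simp only: T_eq)
  qed
  then have "conv_distr M (\<lambda>m \<omega>. SUP k\<in>{m<..}. ereal ((real m / real k) powr (3/2 + \<eta>) * detector Y \<Sigma>m m k \<omega>)) N L"
    unfolding conv_distr_def weak_conv_def F_def[abs_def] by blast
  then show "conv_distr M
             (\<lambda>m \<omega>. SUP k\<in>{m<..}. ereal ((real m / real k) powr (3/2 + \<eta>) * detector Y \<Sigma>m m k \<omega>))
             N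
             (\<lambda>\<omega>. SUP st\<in>{(s, t). 1 \<le> s \<and> s \<le> t}.
                 ereal (snd st powr (- 3/2 - \<eta>) *
                        wnorm (mat 1) (snd st *\<^sub>R W (fst st) \<omega> - fst st *\<^sub>R W (snd st) \<omega>)))
         \<and> (AE \<omega> in N. (SUP st\<in>{(s, t). 1 \<le> s \<and> s \<le> t}.
                 ereal (snd st powr (- 3/2 - \<eta>) *
                        wnorm (mat 1) (snd st *\<^sub>R W (fst st) \<omega> - fst st *\<^sub>R W (snd st) \<omega>))) < \<infinity>)"
    using AE_sup_bridge_finite[OF N W eta] by (simp add: L_def[abs_def])
qed

end
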